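(* Let $F,H$ be real square matrices of the same order and let $\alpha_1,\alpha_2\in\mathbb{R}$. Suppose that $F+\alpha_1H$ and $F+\alpha_2H$ are unstable and have no eigenvalues on the imaginary axis, and that $H$ has rank $1$. Write $H=bc$ with $b$ a real column vector and $c$ a real row vector, and suppose that $(F,b)$ is controllable. Then the following three conditions are equivalent to each other: (ii) there is a common real symmetric matrix $P=P^T$ such that $P(F+\alpha_iH)+(F+\alpha_iH)^TP<0$ for $i=1,2$; (iii) $(F+\alpha_1H)(F+\alpha_2H)$ does not have negative real eigenvalues; (iv) $1-\mathrm{Re}\{(\alpha_2-\alpha_1)\,c\,(jwI-F-\alpha_1H)^{-1}b\}>0$ for all $w\in\mathbb{R}$. Further, if any one of (ii)-(iv) holds, then $F+(1-\lambda)\alpha_1H+\lambda\alpha_2H$ is unstable for all $\lambda\in(0,1)$.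
   Context: A square matrix is called stable if all of its eigenvalues have strictly negative real part, and unstable if it is not stable. For a symmetric matrix $M$, $M<0$ means that $M$ is negative definite. $j$ is the imaginary unit. A pair $(F,b)$ with $F$ of order $m$ and $b$ a column vector is controllable if $[\,b,\ Fb,\ \ldots,\ F^{m-1}b\,]$ has rank $m$. *)

theory Defs
  imports "HOL-Analysis.Analysis"
begin

abbreviation complex_matrix :: "real^'n^'m \<Rightarrow> complex^'n^'m" where
  "complex_matrix A \<equiv> map_matrix complex_of_real A"

definition complex_vector :: "real^'n \<Rightarrow> complex^'n" where
  "complex_vector v = (\<chi> i. complex_of_real (v $ i))"

definition complex_eigenvalue :: "real^'n^'n \<Rightarrow> complex \<Rightarrow> bool" where
  "complex_eigenvalue A z \<longleftrightarrow> (\<exists>v. v \<noteq> 0 \<and> complex_matrix A *v v = z *s v)"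

definition stable_matrix :: "real^'n^'n \<Rightarrow> bool" where
  "stable_matrix A \<longleftrightarrow> (\<forall>z. complex_eigenvalue A z \<longrightarrow> Re z < 0)"

abbreviation unstable_matrix :: "real^'n^'n \<Rightarrow> bool" where
  "unstable_matrix A \<equiv> \<not> stable_matrix A"

definition negative_definite :: "real^'n^'n \<Rightarrow> bool" where
  "negative_definite M \<longleftrightarrow> transpose M = M \<and> (\<forall>x. x \<noteq> 0 \<longrightarrow> x \<bullet> (M *v x) < 0)"

definition outer_product :: "real^'n \<Rightarrow> real^'n \<Rightarrow> real^'n^'n" where
  "outer_product b c = (\<chi> i j. b $ i * c $ j)"

text \<open>
  The columns of the controllability matrix are \<open>b, F b, \<dots>, F\<^sup>m\<^sup>-\<^sup>1 b\<close> with \<open>m = CARD('n)\<close>.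
  As the index type has no canonical order, \<open>to_nat_on UNIV\<close> serves as a bijection from it to
  \<open>{..<m}\<close>; another choice would only permute the columns.
\<close>

definition controllability_matrix :: "real^'n^'n \<Rightarrow> real^'n \<Rightarrow> real^'n^'n" where
  "controllability_matrix F b =
     (\<chi> i j. (((*v) F ^^ to_nat_on (UNIV :: 'n set) j) b) $ i)"

lemma columns_controllability_matrix:
  fixes F :: "real^'n^'n"
  shows "columns (controllability_matrix F b) = (\<lambda>k. ((*v) F ^^ k) b) ` {..<CARD('n)}"
proof -
  have "to_nat_on (UNIV :: 'n set) ` UNIV = {..<CARD('n)}"
    using to_nat_on_finite[of "UNIV :: 'n set"] by (simp add: bij_betw_def)
  moreover have "columns (controllability_matrix F b)
      = (\<lambda>k. ((*v) F ^^ k) b) ` (to_nat_on (UNIV :: 'n set) ` UNIV)"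
    by (auto simp: columns_def column_def controllability_matrix_def image_image)
  ultimately show ?thesis by simp
qed

definition controllable :: "real^'n^'n \<Rightarrow> real^'n \<Rightarrow> bool" where
  "controllable F b \<longleftrightarrow> rank (controllability_matrix F b) = CARD('n)"

text \<open>
  The scalar \<open>c (s I - A)\<^sup>-\<^sup>1 b\<close>, meaningful when \<open>s\<close> is not an eigenvalue of \<open>A\<close>.
\<close>

definition transfer_function :: "real^'n \<Rightarrow> real^'n^'n \<Rightarrow> real^'n \<Rightarrow> complex \<Rightarrow> complex" where
  "transfer_function c A b s =
     (\<Sum>i\<in>UNIV. complex_vector c $ i *
        (matrix_inv (mat s - complex_matrix A) *v complex_vector b) $ i)"

end

theory Submission
  imports Defs "HOL-Computational_Algebra.Fundamental_Theorem_Algebra"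
begin

text \<open>
  Put \<open>A = F + \<alpha>\<^sub>1 H\<close> and \<open>B = F + \<alpha>\<^sub>2 H = A + \<kappa> b c\<close>, where \<open>\<kappa> = \<alpha>\<^sub>2 - \<alpha>\<^sub>1\<close>.

  (iv) implies (ii) by the Kalman-Yakubovich-Popov lemma in its strict form: it provides a symmetric
  \<open>P\<close> and a number \<open>a\<close> with \<open>P x \<bullet> (A x + u b) + a u (\<kappa> c x - u) < 0\<close> for all \<open>(x, u) \<noteq> 0\<close>, and the
  choices \<open>u = 0\<close> and \<open>u = \<kappa> c x\<close> give the two Lyapunov inequalities. If there were no such \<open>P\<close>, a
  separating hyperplane would yield a positive semidefinite matrix with blocks \<open>X, y, v\<close> for which
  \<open>A X + b y\<^sup>T\<close> is skew and \<open>\<kappa> c y \<ge> v\<close>. With \<open>y = X k\<close>, the matrix \<open>A + b k\<^sup>T\<close> is conjugate, on the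
  range of \<open>X\<close>, to a skew matrix \<open>S\<close> by means of \<open>X\<^sup>1\<^sup>/\<^sup>2\<close>; its eigenvectors belong to imaginary
  eigenvalues, and (iv) makes each of them contribute negatively to the trace \<open>\<kappa> c X k - k X k\<close>.

  (ii) implies (iii): if \<open>A B v = x v\<close> with \<open>x < 0\<close>, then the Lyapunov inequalities at \<open>B v\<close> and \<open>v\<close>
  give \<open>P v \<bullet> B v\<close> opposite signs.

  (iii) implies (iv): the real part \<open>p\<close> of \<open>(i w - A)\<^sup>-\<^sup>1 b\<close> satisfies \<open>(A\<^sup>2 + w\<^sup>2) p = - A b\<close>, so if the
  expression in (iv) vanishes then \<open>A B p = - w\<^sup>2 p\<close>; being continuous in \<open>w\<close> and close to 1 for large
  \<open>w\<close>, it is positive.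

  The \<open>P\<close> of (ii) is a Lyapunov matrix for every convex combination of \<open>A\<close> and \<open>B\<close>. If one of them
  were a stable matrix \<open>M\<close>, then for small \<open>\<epsilon> > 0\<close> the form \<open>P x \<bullet> x\<close> would decrease to 0 along the
  iterates of \<open>1 + \<epsilon> M\<close>, so \<open>P\<close> would be positive definite and hence \<open>A\<close> stable.
\<close>

section \<open>Orthonormal eigenbases of self-adjoint maps\<close>

definition orthonormal_family :: "('i \<Rightarrow> 'a::real_inner) \<Rightarrow> 'i set \<Rightarrow> bool" where
  "orthonormal_family e I \<longleftrightarrow> (\<forall>i\<in>I. \<forall>j\<in>I. e i \<bullet> e j = (if i = j then 1 else 0))"

text \<open>For small \<open>t\<close> of sign opposite to \<open>a\<close> the linear term would
  win. This first-order condition serves at the maximum of a Rayleigh quotient and on the kernel of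
  a semidefinite form.\<close>

lemma linear_coeff_zero:
  fixes a b :: real
  assumes "\<And>t. 0 \<le> 2 * t * a + t\<^sup>2 * b"
  shows "a = 0"
proof (rule ccontr)
  assume a: "a \<noteq> 0"
  \<comment> \<open>With this \<open>t\<close>, the product \<open>t * b\<close> is at most
    \<open>a\<close> in absolute value, so the quadratic term is at most half as large as the linear
    one. The added 1 keeps the denominator positive.\<close>
  define t where "t = - a / (\<bar>b\<bar> + 1)"
  have t: "t * (\<bar>b\<bar> + 1) = - a" by (simp add: t_def)
  have "0 \<le> (2 * t * a + t\<^sup>2 * b) * (\<bar>b\<bar> + 1)"
    using assms[of t] by (intro mult_nonneg_nonneg) auto
  also have "\<dots> = 2 * a * (t * (\<bar>b\<bar> + 1)) + t * b * (t * (\<bar>b\<bar> + 1))"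
    by (simp add: algebra_simps power2_eq_square)
  also have "\<dots> = - 2 * a\<^sup>2 - a * (t * b)"
    unfolding t by (simp add: power2_eq_square)
  finally have "2 * a\<^sup>2 \<le> - (a * (t * b))" by linarith
  also have "\<dots> \<le> \<bar>a\<bar> * \<bar>t * b\<bar>"
    unfolding abs_mult[symmetric] by (rule abs_ge_minus_self)
  also have "\<dots> \<le> \<bar>a\<bar> * \<bar>a\<bar>"
  proof (rule mult_left_mono)
    have "\<bar>t\<bar> * (\<bar>b\<bar> + 1) = \<bar>a\<bar>"
      using arg_cong[OF t, of abs] by (simp add: abs_mult)
    then show "\<bar>t * b\<bar> \<le> \<bar>a\<bar>"
      by (simp add: abs_mult distrib_left)
  qed simp
  finally have "a * a \<le> 0" by (simp add: power2_eq_square)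
  then show False using a by (metis mult_eq_0_iff zero_le_square order_antisym)
qed

text \<open>A maximiser of the Rayleigh quotient on the unit sphere of \<open>V\<close> is an
  eigenvector: its residual stays in \<open>V\<close> by invariance, and perturbing along it shows
  that it vanishes.\<close>

lemma selfadjoint_eigenvector:
  fixes f :: "'a::euclidean_space \<Rightarrow> 'a"
  assumes f: "linear f" and sym: "\<And>x y. f x \<bullet> y = x \<bullet> f y"
    and V: "subspace V" "f ` V \<subseteq> V" "V \<noteq> {0}"
  obtains x \<mu> where "x \<in> V" "norm x = 1" "f x = \<mu> *\<^sub>R x"
proof -
  obtain v where v: "v \<in> V" "v \<noteq> 0"
    using V subspace_0 by blast
  have "v /\<^sub>R norm v \<in> V \<inter> sphere 0 1"
    using v V by (simp add: subspace_scale)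
  then have ne: "V \<inter> sphere 0 1 \<noteq> {}" by blast
  have co: "compact (V \<inter> sphere 0 1)"
    by (intro closed_Int_compact closed_subspace V) auto
  have "continuous_on (V \<inter> sphere 0 1) (\<lambda>x. x \<bullet> f x)"
    by (intro continuous_intros linear_continuous_on linear_conv_bounded_linear[THEN iffD1] f)
  then obtain x where x: "x \<in> V" "norm x = 1"
    and max: "\<And>y. y \<in> V \<Longrightarrow> norm y = 1 \<Longrightarrow> y \<bullet> f y \<le> x \<bullet> f x"
    using continuous_attains_sup[OF co ne] by fastforce
  define \<mu> where "\<mu> = x \<bullet> f x"
  have max': "y \<bullet> f y \<le> \<mu> * (y \<bullet> y)" if "y \<in> V" for y
  proof (cases "y = 0")
    case True then show ?thesis by (simp add: linear_0[OF f])
  next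
    case False
    have "(y /\<^sub>R norm y) \<bullet> f (y /\<^sub>R norm y) \<le> \<mu>"
      unfolding \<mu>_def using False that V by (intro max) (auto simp: subspace_scale)
    then show ?thesis using False
      by (simp add: linear_scale[OF f] field_simps power2_norm_eq_inner[symmetric] power2_eq_square)
  qed
  define z where "z = \<mu> *\<^sub>R x - f x"
  have "z \<in> V" unfolding z_def using x V by (auto intro!: subspace_diff subspace_scale)
  \<comment> \<open>In \<open>max'\<close> at \<open>x + t z\<close> the constant terms cancel, and
    as \<open>z\<close> is orthogonal to \<open>x\<close>, the linear coefficient is
    \<open>z \<bullet> z\<close>.\<close>
  have "z \<bullet> z = 0"
  proof (rule linear_coeff_zero)
    fix t :: real
    have "x + t *\<^sub>R z \<in> V" using x \<open>z \<in> V\<close> V by (auto intro!: subspace_add subspace_scale)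
    note max'[OF this]
    moreover have "x \<bullet> x = 1" using x by (simp add: power2_norm_eq_inner[symmetric])
    moreover have "f x = \<mu> *\<^sub>R x - z" by (simp add: z_def)
    moreover have "x \<bullet> f z = z \<bullet> f x" using sym[of x z] by (simp add: inner_commute)
    moreover have "x \<bullet> f x = \<mu>" by (simp add: \<mu>_def)
    moreover have "z \<bullet> x = 0"
      using \<open>x \<bullet> x = 1\<close> by (simp add: z_def \<mu>_def inner_diff_left inner_diff_right inner_commute)
    ultimately show "0 \<le> 2 * t * (z \<bullet> z) + t\<^sup>2 * (\<mu> * (z \<bullet> z) - z \<bullet> f z)"
      by (simp add: linear_add[OF f] linear_scale[OF f] inner_add_left inner_add_right
          inner_diff_right inner_commute[of x z] algebra_simps power2_eq_square)
  qed
  then show ?thesis using that[of x \<mu>] x by (simp add: z_def)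
qed

text \<open>The orthogonal complement of the eigenvectors found so far is invariant, and it is
  nonzero as long as an index is left, since \<open>'n\<close> has as many elements as the space has
  dimensions.\<close>

theorem selfadjoint_eigenbasis:
  fixes f :: "real^'n \<Rightarrow> real^'n"
  assumes f: "linear f" and sym: "\<And>x y. f x \<bullet> y = x \<bullet> f y"
  shows "\<exists>(e :: 'n \<Rightarrow> real^'n) \<mu>. orthonormal_family e UNIV \<and> (\<forall>i. f (e i) = \<mu> i *\<^sub>R e i)"
proof -
  have "\<exists>(e :: 'n \<Rightarrow> real^'n) \<mu>. orthonormal_family e I \<and> (\<forall>i\<in>I. f (e i) = \<mu> i *\<^sub>R e i)" for I :: "'n set"
    using finite[of I]
  proof (induction I rule: finite_induct)
    case empty
    then show ?case by (simp add: orthonormal_family_def)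
  next
    case (insert i I)
    then obtain e :: "'n \<Rightarrow> real^'n" and \<mu> where e: "orthonormal_family e I"
      and \<mu>: "\<And>j. j \<in> I \<Longrightarrow> f (e j) = \<mu> j *\<^sub>R e j" by blast
    define V where "V = {x. \<forall>j\<in>I. e j \<bullet> x = 0}"
    have V: "subspace V"
      by (auto simp: V_def subspace_def inner_add_right)
    have inv: "f ` V \<subseteq> V"
      by (auto simp: V_def sym[symmetric] \<mu>)
    have "dim (e ` I) \<le> card (e ` I)" by (rule dim_le_card) (auto simp: insert span_superset)
    also have "\<dots> \<le> card I" by (rule card_image_le) (rule insert)
    also have "\<dots> < card (UNIV :: 'n set)"
      using insert by (intro psubset_card_mono) auto
    finally have "dim (e ` I) < DIM(real^'n)" by simp
    then obtain x where "x \<noteq> 0" and x: "\<And>y. y \<in> span (e ` I) \<Longrightarrow> orthogonal x y"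
      using orthogonal_to_subspace_exists[of "e ` I"] by auto
    then have "x \<in> V" "x \<noteq> 0"
      using x[OF span_base[OF imageI]] by (auto simp: V_def orthogonal_def inner_commute)
    then have "V \<noteq> {0}" by blast
    then obtain d \<nu> where d: "d \<in> V" "norm d = 1" "f d = \<nu> *\<^sub>R d"
      using selfadjoint_eigenvector[OF f sym V inv] by blast
    have "d \<bullet> d = 1" using d by (simp add: power2_norm_eq_inner[symmetric])
    then have "orthonormal_family (e(i := d)) (insert i I)"
      using e d \<open>i \<notin> I\<close> by (auto simp: orthonormal_family_def V_def inner_commute)
    moreover have "\<forall>j\<in>insert i I. f ((e(i := d)) j) = (\<mu>(i := \<nu>)) j *\<^sub>R (e(i := d)) j"
      using \<mu> d \<open>i \<notin> I\<close> by auto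
    ultimately show ?case by blast
  qed
  from this[of UNIV] show ?thesis by simp
qed

text \<open>The matrix with rows \<open>e i\<close> is square, so orthonormal rows make it
  orthogonal; it sends \<open>x\<close> to its list of coefficients.\<close>

lemma orthonormal_family_parseval:
  fixes e :: "'n::finite \<Rightarrow> real^'n"
  assumes "orthonormal_family e UNIV"
  shows "(\<Sum>i\<in>UNIV. (x \<bullet> e i) * (y \<bullet> e i)) = x \<bullet> y"
proof -
  define Q where "Q = (\<chi> i. e i)"
  have "Q ** transpose Q = mat 1"
    using assms by (simp add: vec_eq_iff matrix_matrix_mult_def transpose_def mat_def Q_def
        orthonormal_family_def inner_vec_def)
  then have "orthogonal_matrix (transpose Q)"
    by (simp add: orthogonal_matrix)
  then have "orthogonal_matrix Q" 
    by (simp add: orthogonal_matrix_transpose)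
  then have "orthogonal_transformation ((*v) Q)"
    by (simp add: orthogonal_transformation_matrix)
  then have "(Q *v x) \<bullet> (Q *v y) = x \<bullet> y"
    by (simp add: orthogonal_transformation_def)
  moreover have "(Q *v x) $ i = x \<bullet> e i" for x i
    by (simp add: Q_def matrix_vector_mul_component inner_commute)
  ultimately show ?thesis by (simp add: inner_vec_def[of "Q *v x"])
qed

lemma orthonormal_family_expansion:
  fixes e :: "'n::finite \<Rightarrow> real^'n"
  assumes "orthonormal_family e UNIV"
  shows "(\<Sum>i\<in>UNIV. (x \<bullet> e i) *\<^sub>R e i) = x"
proof -
  have "(\<Sum>i\<in>UNIV. (x \<bullet> e i) *\<^sub>R e i) \<bullet> y = x \<bullet> y" for y
    using orthonormal_family_parseval[OF assms, of x y]
    by (simp add: inner_sum_left inner_commute[of "e _" y])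
  then show ?thesis using vector_eq_rdot by blast
qed

section \<open>Semidefinite forms and the functional calculus of a symmetric matrix\<close>

lemma nonneg_form_isotropic:
  fixes X :: "real^'n^'n"
  assumes psd: "\<And>\<xi> s. 0 \<le> \<xi> \<bullet> (X *v \<xi>) + 2 * s * (y \<bullet> \<xi>) + s\<^sup>2 * v"
    and "X *v \<xi> = 0"
  shows "y \<bullet> \<xi> = 0"
  using psd[of \<xi>] \<open>X *v \<xi> = 0\<close> by (intro linear_coeff_zero[of _ v]) simp

locale eigenbasis =
  fixes X :: "real^'n^'n" and e :: "'n \<Rightarrow> real^'n" and \<mu> :: "'n \<Rightarrow> real"
  assumes ortho: "orthonormal_family e UNIV"
    and eigen: "\<And>i. X *v e i = \<mu> i *\<^sub>R e i"
begin

text \<open>This is \<open>\<phi>(X)\<close>. Only the values of \<open>\<phi>\<close> at the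
  eigenvalues enter, so discontinuous functions such as a pseudo-inverse are allowed.\<close>

definition calc :: "(real \<Rightarrow> real) \<Rightarrow> real^'n \<Rightarrow> real^'n" where
  "calc \<phi> x = (\<Sum>i\<in>UNIV. (\<phi> (\<mu> i) * (x \<bullet> e i)) *\<^sub>R e i)"

lemma inner_basis: "e i \<bullet> e j = (if i = j then 1 else 0)"
  using ortho by (simp add: orthonormal_family_def)

lemma calc_coeff [simp]: "calc \<phi> x \<bullet> e i = \<phi> (\<mu> i) * (x \<bullet> e i)"
proof -
  have "calc \<phi> x \<bullet> e i = (\<Sum>j\<in>UNIV. if j = i then \<phi> (\<mu> j) * (x \<bullet> e j) else 0)"
    unfolding calc_def inner_sum_left by (intro sum.cong) (auto simp: inner_basis)
  then show ?thesis by simp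
qed

lemma coeff_eqI: "(\<And>i. x \<bullet> e i = y \<bullet> e i) \<Longrightarrow> x = y"
  by (metis (no_types, lifting) orthonormal_family_expansion[OF ortho] sum.cong)

lemma linear_calc: "linear (calc \<phi>)"
  by (rule linearI) (auto intro!: coeff_eqI simp: inner_add_left algebra_simps)

lemma calc_sym: "calc \<phi> x \<bullet> y = x \<bullet> calc \<phi> y"
  unfolding orthonormal_family_parseval[OF ortho, of "calc \<phi> x" y, symmetric]
    orthonormal_family_parseval[OF ortho, of x "calc \<phi> y", symmetric]
  by (simp add: mult_ac)

lemma calc_id: "calc (\<lambda>t. t) x = X *v x"
proof -
  have "X *v x = X *v (\<Sum>i\<in>UNIV. (x \<bullet> e i) *\<^sub>R e i)"
    by (simp add: orthonormal_family_expansion[OF ortho])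
  also have "\<dots> = calc (\<lambda>t. t) x"
    unfolding calc_def
    by (simp add: linear_sum[OF matrix_vector_mul_linear] matrix_vector_mult_scaleR eigen mult.commute)
  finally show ?thesis by simp
qed

lemma calc_comp: "calc \<phi> (calc \<psi> x) = calc (\<lambda>t. \<phi> t * \<psi> t) x"
  by (rule coeff_eqI) simp

end

section \<open>The Kalman-Yakubovich-Popov lemma\<close>

text \<open>The block matrix with rows \<open>(X, y)\<close> and \<open>(y, v)\<close> is symmetric,
  positive semidefinite and of trace 1; the trace excludes the zero matrix.\<close>

definition dual_feasible :: "real^'n^'n \<Rightarrow> real^'n \<Rightarrow> real \<Rightarrow> bool" where
  "dual_feasible X y v \<longleftrightarrow>
     (\<forall>\<xi> \<eta>. \<xi> \<bullet> (X *v \<eta>) = (X *v \<xi>) \<bullet> \<eta>) \<and>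
     (\<forall>\<xi> s. 0 \<le> \<xi> \<bullet> (X *v \<xi>) + 2 * s * (y \<bullet> \<xi>) + s\<^sup>2 * v) \<and> trace X + v = 1"

text \<open>The equations in \<open>freq\<close> say that \<open>A\<close> applied to
  \<open>f + \<i> e\<close>, plus \<open>s + \<i> t\<close> times \<open>b\<close>, is
  \<open>\<i> w\<close> times \<open>f + \<i> e\<close>. Such vectors are obtained from a spectral
  decomposition of the skew map \<open>S\<close>, and their contributions add up to a trace that
  bounds \<open>c \<bullet> y - v\<close>.\<close>

lemma dual_infeasible:
  fixes A X :: "real^'n^'n" and b c y :: "real^'n"
  assumes freq: "\<And>w s t f e. A *v f + s *\<^sub>R b = - w *\<^sub>R e \<Longrightarrow> A *v e + t *\<^sub>R b = w *\<^sub>R f \<Longrightarrow>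
      f \<noteq> 0 \<or> e \<noteq> 0 \<Longrightarrow> s * (c \<bullet> f - s) + t * (c \<bullet> e - t) < 0"
    and dual: "dual_feasible X y v"
    and skew: "\<And>\<xi> \<eta>. \<eta> \<bullet> (A *v (X *v \<xi>) + (y \<bullet> \<xi>) *\<^sub>R b) = - (\<xi> \<bullet> (A *v (X *v \<eta>) + (y \<bullet> \<eta>) *\<^sub>R b))"
  shows "c \<bullet> y < v"
proof -
  have sym: "\<xi> \<bullet> (X *v \<eta>) = (X *v \<xi>) \<bullet> \<eta>"
    and psd: "0 \<le> \<xi> \<bullet> (X *v \<xi>) + 2 * s * (y \<bullet> \<xi>) + s\<^sup>2 * v"
    and tr: "trace X + v = 1" for \<xi> \<eta> s
    using dual unfolding dual_feasible_def by blast+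
  obtain d :: "'n \<Rightarrow> real^'n" and \<mu> where d: "orthonormal_family d UNIV" "\<And>i. X *v d i = \<mu> i *\<^sub>R d i"
    using selfadjoint_eigenbasis[OF matrix_vector_mul_linear sym[symmetric]] by blast
  interpret eigenbasis X d \<mu> using d by (simp add: eigenbasis_def)
  have \<mu>: "\<mu> i \<ge> 0" for i
    using psd[of "d i" 0] inner_basis[of i i] by (simp add: eigen)
  have yd: "y \<bullet> d i = 0" if "\<mu> i = 0" for i
    using nonneg_form_isotropic[OF psd, of "d i"] that by (simp add: eigen)
  \<comment> \<open>\<open>G\<close> is the square root of \<open>X\<close> and \<open>J\<close> its pseudo-inverse, thanks to \<open>1 / 0 = 0\<close>.\<close>
  define G where "G = calc sqrt"
  define J where "J = calc (\<lambda>t. 1 / sqrt t)"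
  have lin: "linear G" "linear J" by (simp_all add: G_def J_def linear_calc)
  have GG: "G (G x) = X *v x" for x
    unfolding G_def calc_comp calc_id[symmetric] by (rule coeff_eqI) (simp add: \<mu>)
  have XJ: "X *v J x = G x" for x
    unfolding G_def J_def calc_id[symmetric] calc_comp
    by (rule coeff_eqI) (simp add: real_div_sqrt \<mu>)
  have GJ: "G (J x) = x" if "\<And>i. \<mu> i = 0 \<Longrightarrow> x \<bullet> d i = 0" for x
    unfolding G_def J_def calc_comp by (rule coeff_eqI) (use that in force)
  \<comment> \<open>\<open>J J\<close> is the pseudo-inverse of \<open>X\<close>. It solves
    \<open>X k = y\<close> because \<open>y\<close> is orthogonal to the kernel of \<open>X\<close>
    by \<open>yd\<close>.\<close>
  define k where "k = J (J y)"
  have Xk: "X *v k = y"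
    unfolding k_def XJ using GJ[OF yd] by simp
  define B where "B x = A *v x + (k \<bullet> x) *\<^sub>R b" for x
  have linB: "linear B"
    unfolding B_def by (intro linearI) (auto simp: algebra_simps inner_add_right)
  have BX: "B (X *v \<xi>) = A *v (X *v \<xi>) + (y \<bullet> \<xi>) *\<^sub>R b" for \<xi>
    unfolding B_def sym Xk ..
  have skewB: "\<eta> \<bullet> B (X *v \<xi>) = - (\<xi> \<bullet> B (X *v \<eta>))" for \<xi> \<eta>
    unfolding BX by (rule skew)
  \<comment> \<open>Since \<open>G = X J\<close>, this is \<open>B X\<close> multiplied by the
    symmetric \<open>J\<close> on both sides, so it inherits the skewness of
    \<open>B X\<close>.\<close>
  define S where "S x = J (B (G x))" for x
  have linS: "linear S"
    unfolding S_def using linear_compose[OF linear_compose[OF lin(1) linB] lin(2)] by (simp add: o_def)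
  have S_skew: "x \<bullet> S z = - (z \<bullet> S x)" for x z
    using skewB[of "J x" "J z"] unfolding S_def XJ[symmetric] J_def calc_sym[symmetric] by simp
  \<comment> \<open>\<open>G J\<close> is the identity only off the kernel of \<open>X\<close>; by
    skewness, the range of \<open>B G\<close> is orthogonal to that kernel.\<close>
  have GS: "G (S x) = B (G x)" for x
    unfolding S_def
  proof (rule GJ)
    fix i assume "\<mu> i = 0"
    then have "X *v d i = 0" by (simp add: eigen)
    then have "B (X *v d i) = 0" using linear_0[OF linB] by simp
    then show "B (G x) \<bullet> d i = 0"
      using skewB[of "d i" "J x"] by (simp add: XJ inner_commute)
  qed
  \<comment> \<open>The square of a skew map is self-adjoint, so the real spectral theorem replaces
    the one for skew maps.\<close>
  obtain p :: "'n \<Rightarrow> real^'n" and \<nu> where p: "orthonormal_family p UNIV" and p_eigen: "\<And>i. S (S (p i)) = \<nu> i *\<^sub>R p i"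
  proof -
    have "linear (\<lambda>x. S (S x))" using linear_compose[OF linS linS] by (simp add: o_def)
    moreover have "S (S x) \<bullet> z = x \<bullet> S (S z)" for x z
      using S_skew[of z "S x"] S_skew[of x "S z"] by (simp add: inner_commute)
    ultimately show ?thesis using selfadjoint_eigenbasis[of "\<lambda>x. S (S x)"] that by blast
  qed
  have pp: "p i \<bullet> p j = (if i = j then 1 else 0)" for i j
    using p by (simp add: orthonormal_family_def)
  define w where "w i = norm (S (p i))" for i
  have SS: "S (p i) \<bullet> S (p j) = (if i = j then (w i)\<^sup>2 else 0)" for i j
  proof (cases "i = j")
    case True then show ?thesis by (simp add: w_def power2_norm_eq_inner)
  next
    case False then show ?thesis
      using S_skew[of "S (p i)" "p j"] p_eigen[of i] pp[of j i] by simp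
  qed
  have \<nu>: "\<nu> i = - (w i)\<^sup>2" for i
    using S_skew[of "p i" "S (p i)"] SS[of i i] p_eigen[of i] pp[of i i] by simp
  have S0: "S (p i) = 0" if "w i = 0" for i using that by (simp add: w_def)
  \<comment> \<open>The vector \<open>q i + \<i> p i\<close> is an eigenvector of \<open>S\<close> for the eigenvalue \<open>\<i> w i\<close>; both
    families are orthonormal, so both compute the same trace.\<close>
  define q where "q i = (if w i = 0 then p i else (1 / w i) *\<^sub>R S (p i))" for i
  have Sq: "S (q i) = - w i *\<^sub>R p i" for i
    using S0[of i] p_eigen[of i]
    by (simp add: q_def \<nu> linear_scale[OF linS] power2_eq_square)
  have Sp: "S (p i) = w i *\<^sub>R q i" for i
    using S0[of i] by (simp add: q_def)
  \<comment> \<open>This settles the orthogonality of \<open>q i\<close> and \<open>q j\<close> when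
    exactly one of \<open>w i\<close>, \<open>w j\<close> is zero.\<close>
  have Spp: "S (p i) \<bullet> p j = 0" if "w j = 0" for i j
    using S_skew[of "p j" "p i"] S0[OF that] by (simp add: inner_commute)
  have q: "orthonormal_family q UNIV"
    unfolding orthonormal_family_def
  proof (intro ballI)
    fix i j
    show "q i \<bullet> q j = (if i = j then 1 else 0)"
      using pp[of i j] SS[of i j] Spp[of i j] Spp[of j i]
      by (auto simp: q_def inner_commute power2_eq_square)
  qed
  \<comment> \<open>The sum is the trace of a bilinear form, so it is the same for every orthonormal
    basis; by Parseval it is \<open>G k \<bullet> G (c - k)\<close>.\<close>
  have trace: "(\<Sum>i\<in>UNIV. (k \<bullet> G (r i)) * (c \<bullet> G (r i) - k \<bullet> G (r i))) = c \<bullet> y - k \<bullet> y"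
    if r: "orthonormal_family r UNIV" for r :: "'n \<Rightarrow> real^'n"
  proof -
    have "k \<bullet> G (r i) = G k \<bullet> r i" "c \<bullet> G (r i) - k \<bullet> G (r i) = G (c - k) \<bullet> r i" for i
      unfolding linear_diff[OF lin(1)] inner_diff_left G_def calc_sym by auto
    then have "(\<Sum>i\<in>UNIV. (k \<bullet> G (r i)) * (c \<bullet> G (r i) - k \<bullet> G (r i))) = G k \<bullet> G (c - k)"
      using orthonormal_family_parseval[OF r] by simp
    also have "\<dots> = (c - k) \<bullet> y"
      using Xk calc_sym[of sqrt "c - k" "G k"] by (simp add: G_def[symmetric] GG inner_commute)
    finally show ?thesis by (simp add: inner_diff_left)
  qed
  define term_at where "term_at i = (k \<bullet> G (q i)) * (c \<bullet> G (q i) - k \<bullet> G (q i))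
      + (k \<bullet> G (p i)) * (c \<bullet> G (p i) - k \<bullet> G (p i))" for i
  \<comment> \<open>\<open>G\<close> carries the eigenvector \<open>q i + \<i> p i\<close> of
    \<open>S\<close> to one of \<open>B\<close>, and \<open>freq\<close> applies with the inputs
    \<open>s\<close>, \<open>t\<close> given by the feedback \<open>k\<close>.\<close>
  have neg: "term_at i < 0" if "G (p i) \<noteq> 0" for i
    unfolding term_at_def
  proof (rule freq[where w = "w i"])
    show "A *v G (q i) + (k \<bullet> G (q i)) *\<^sub>R b = - w i *\<^sub>R G (p i)"
      using GS[of "q i"] by (simp add: B_def Sq linear_scale[OF lin(1)] linear_neg[OF lin(1)])
    show "A *v G (p i) + (k \<bullet> G (p i)) *\<^sub>R b = w i *\<^sub>R G (q i)"
      using GS[of "p i"] by (simp add: B_def Sp linear_scale[OF lin(1)])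
    show "G (q i) \<noteq> 0 \<or> G (p i) \<noteq> 0" using that by simp
  qed
  have nonpos: "term_at i \<le> 0" for i
  proof (cases "G (p i) = 0")
    case True
    \<comment> \<open>By \<open>GS\<close> at \<open>p i\<close>, the vector \<open>w i\<close>
      times \<open>G (q i)\<close> equals \<open>B (G (p i)) = 0\<close>.\<close>
    then have "w i \<noteq> 0 \<Longrightarrow> G (q i) = 0"
      using GS[of "p i"] linear_0[OF linB]  by (simp add: Sp linear_scale[OF lin(1)])
    moreover have "w i = 0 \<Longrightarrow> G (q i) = 0" using True by (simp add: q_def)
    ultimately have "G (q i) = 0" by blast
    then show ?thesis using True by (simp add: term_at_def)
  next
    case False
    then show ?thesis using neg[of i] by simp
  qed
  have sum: "(\<Sum>i\<in>UNIV. term_at i) = 2 * (c \<bullet> y - k \<bullet> y)"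
    unfolding term_at_def sum.distrib trace[OF p] trace[OF q] by simp
  \<comment> \<open>The form at \<open>(- k, 1)\<close> is the Schur complement
    \<open>v - k \<bullet> y\<close>.\<close>
  have kv: "k \<bullet> y \<le> v"
    using psd[of "- k" 1] by (simp add: linear_neg[OF matrix_vector_mul_linear] Xk inner_commute)
  show ?thesis
  proof (cases "\<forall>i. G (p i) = 0")
    case True
    \<comment> \<open>In this degenerate case \<open>X = 0\<close>, hence \<open>y = 0\<close>, and
      the trace condition gives \<open>v = 1\<close>.\<close>
    have "G x = 0" for x
    proof -
      have "G x = G (\<Sum>i\<in>UNIV. (x \<bullet> p i) *\<^sub>R p i)"
        using orthonormal_family_expansion[OF p] by simp
      also have "\<dots> = 0" using True by (simp add: linear_sum[OF lin(1)] linear_scale[OF lin(1)])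
      finally show ?thesis .
    qed
    then have "X *v x = 0" for x using GG[of x] by metis
    then have "X = 0" by (simp add: matrix_eq)
    then show ?thesis using Xk tr by (auto simp: trace_def)
  next
    case False
    then have "(\<Sum>i\<in>UNIV. term_at i) < 0"
      using neg nonpos by (intro sum_strict_mono_ex1[where g = "\<lambda>_. 0", simplified]) auto
    then have "c \<bullet> y - k \<bullet> y < 0" unfolding sum by simp
    then show ?thesis using kv by simp
  qed
qed

section \<open>Duality: separating the image of the semidefinite blocks\<close>

lemma inner_transpose_mult: "x \<bullet> (transpose A *v y) = (A *v x) \<bullet> y" for A :: "real^'n^'m"
  by (metis dot_lmul_matrix inner_commute transpose_matrix_vector)

lemma outer_product_mult: "outer_product p q *v x = (q \<bullet> x) *\<^sub>R p"
  by (simp add: vec_eq_iff outer_product_def matrix_vector_mult_def inner_vec_def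
      sum_distrib_left sum_distrib_right mult_ac)

lemma inner_outer_product: "Q \<bullet> outer_product p x = p \<bullet> (Q *v x)"
  by (simp add: inner_vec_def outer_product_def matrix_vector_mult_def sum_distrib_left mult_ac)

lemma inner_transpose: "transpose Q \<bullet> Z = Q \<bullet> transpose Z" for Q Z :: "real^'n^'n"
  by (simp add: inner_vec_def transpose_def) (rule sum.swap)

text \<open>The form of \<open>P A + A^T P\<close> at \<open>x\<close> is twice
  \<open>(P x) \<bullet> (A x)\<close>; the later arguments use only this scalar version.\<close>

lemma negative_definite_lyapunov_iff:
  fixes P A :: "real^'n^'n"
  assumes "transpose P = P"
  shows "negative_definite (P ** A + transpose A ** P) \<longleftrightarrow> (\<forall>x. x \<noteq> 0 \<longrightarrow> (P *v x) \<bullet> (A *v x) < 0)"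
proof -
  have "transpose (P ** A + transpose A ** P) = P ** A + transpose A ** P"
    using assms by (simp add: transpose_def vec_eq_iff matrix_matrix_mult_def mult.commute)
  moreover have "x \<bullet> ((P ** A + transpose A ** P) *v x) = 2 * ((P *v x) \<bullet> (A *v x))" for x
    using inner_transpose_mult[of x P "A *v x"] inner_transpose_mult[of x A "P *v x"]
    by (simp add: assms matrix_vector_mult_add_rdistrib inner_add_right inner_commute
        flip: matrix_vector_mul_assoc)
  ultimately show ?thesis by (simp add: negative_definite_def)
qed

text \<open>The two components are the quantities paired with the unknowns \<open>a\<close> and
  \<open>P\<close> of the Kalman-Yakubovich-Popov inequality, as the block matrix runs through the
  feasible ones.\<close>

definition dual_image :: "real^'n^'n \<Rightarrow> real^'n \<Rightarrow> real^'n \<Rightarrow> (real \<times> (real^'n^'n)) set" where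
  "dual_image A b c = {(c \<bullet> y - v, Z + transpose Z) | X y v Z.
     dual_feasible X y v \<and> Z = A ** X + outer_product b y}"

lemma dual_feasible_convex:
  assumes "dual_feasible X y v" "dual_feasible X' y' v'" "0 \<le> s" "0 \<le> t" "s + t = 1"
  shows "dual_feasible (s *\<^sub>R X + t *\<^sub>R X') (s *\<^sub>R y + t *\<^sub>R y') (s * v + t * v')"
proof -
  note mv = matrix_vector_mult_add_rdistrib scaleR_matrix_vector_assoc[symmetric]
  have *: "\<xi> \<bullet> ((s *\<^sub>R X + t *\<^sub>R X') *v \<xi>) + 2 * r * ((s *\<^sub>R y + t *\<^sub>R y') \<bullet> \<xi>) + r\<^sup>2 * (s * v + t * v')
    = s * (\<xi> \<bullet> (X *v \<xi>) + 2 * r * (y \<bullet> \<xi>) + r\<^sup>2 * v)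
      + t * (\<xi> \<bullet> (X' *v \<xi>) + 2 * r * (y' \<bullet> \<xi>) + r\<^sup>2 * v')" for \<xi> r
    by (simp add: mv inner_add_left inner_add_right algebra_simps)
  have "trace (s *\<^sub>R X + t *\<^sub>R X') = s * trace X + t * trace X'"
    by (simp add: trace_def sum.distrib sum_distrib_left)
  then have "trace (s *\<^sub>R X + t *\<^sub>R X') + (s * v + t * v') = s * (trace X + v) + t * (trace X' + v')"
    by (simp add: algebra_simps)
  then show ?thesis
    using assms unfolding dual_feasible_def *
    by (auto simp: mv inner_add_left inner_add_right)
qed

lemma convex_dual_image:
  fixes A :: "real^'n^'n"
  shows "convex (dual_image A b c)"
proof (rule convexI)
  fix p q :: "real \<times> (real^'n^'n)" and s t :: real
  assume "p \<in> dual_image A b c" "q \<in> dual_image A b c" and st: "0 \<le> s" "0 \<le> t" "s + t = 1"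
  then obtain X y v Z X' y' v' Z' where
    p: "p = (c \<bullet> y - v, Z + transpose Z)" "dual_feasible X y v" "Z = A ** X + outer_product b y" and
    q: "q = (c \<bullet> y' - v', Z' + transpose Z')" "dual_feasible X' y' v'" "Z' = A ** X' + outer_product b y'"
    unfolding dual_image_def by blast
  define W where "W = s *\<^sub>R Z + t *\<^sub>R Z'"
  have "W = A ** (s *\<^sub>R X + t *\<^sub>R X') + outer_product b (s *\<^sub>R y + t *\<^sub>R y')"
    by (simp add: W_def p q vec_eq_iff matrix_matrix_mult_def outer_product_def sum.distrib
        sum_distrib_left algebra_simps)
  moreover have "s *\<^sub>R p + t *\<^sub>R q
      = (c \<bullet> (s *\<^sub>R y + t *\<^sub>R y') - (s * v + t * v'), W + transpose W)"
    by (simp add: W_def p(1) q(1) vec_eq_iff transpose_def inner_add_right algebra_simps)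
  ultimately show "s *\<^sub>R p + t *\<^sub>R q \<in> dual_image A b c"
    unfolding dual_image_def using dual_feasible_convex[OF p(2) q(2) st] by blast
qed

text \<open>The block matrix is the outer square of \<open>(x, u)\<close>, whose form is the square
  of \<open>x \<bullet> \<xi> + s u\<close>.\<close>

lemma dual_feasible_rank_one:
  assumes "x \<bullet> x + u\<^sup>2 = 1"
  shows "dual_feasible (outer_product x x) (u *\<^sub>R x) (u\<^sup>2)"
proof -
  have "0 \<le> \<xi> \<bullet> (outer_product x x *v \<xi>) + 2 * s * (u *\<^sub>R x \<bullet> \<xi>) + s\<^sup>2 * u\<^sup>2" for \<xi> s
  proof -
    have "\<xi> \<bullet> (outer_product x x *v \<xi>) + 2 * s * (u *\<^sub>R x \<bullet> \<xi>) + s\<^sup>2 * u\<^sup>2 = (x \<bullet> \<xi> + s * u)\<^sup>2"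
      by (simp add: outer_product_mult inner_commute power2_eq_square algebra_simps)
    then show ?thesis by simp
  qed
  moreover have "trace (outer_product x x) = x \<bullet> x"
    by (simp add: trace_def outer_product_def inner_vec_def)
  ultimately show ?thesis
    using assms by (simp add: dual_feasible_def outer_product_mult inner_commute)
qed

text \<open>A theorem of the alternative: a point of \<open>C\<close> in \<open>T\<close> would be a
  feasible block matrix with \<open>c \<bullet> y \<ge> v\<close> and a skew \<open>Z\<close>,
  against \<open>dual_infeasible\<close>. So a hyperplane separates \<open>C\<close> from
  \<open>T\<close>, and its normal supplies \<open>a\<close> and \<open>P\<close>.\<close>

theorem kyp_lemma:
  fixes A :: "real^'n^'n" and b c :: "real^'n"
  assumes freq: "\<And>w s t f e. A *v f + s *\<^sub>R b = - w *\<^sub>R e \<Longrightarrow> A *v e + t *\<^sub>R b = w *\<^sub>R f \<Longrightarrow>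
      f \<noteq> 0 \<or> e \<noteq> 0 \<Longrightarrow> s * (c \<bullet> f - s) + t * (c \<bullet> e - t) < 0"
  shows "\<exists>(P :: real^'n^'n) a. transpose P = P \<and> (\<forall>x u. x \<noteq> 0 \<or> u \<noteq> 0 \<longrightarrow>
    (P *v x) \<bullet> (A *v x + u *\<^sub>R b) + a * (u * (c \<bullet> x) - u\<^sup>2) < 0)"
proof -
  define Z where "Z x u = outer_product (A *v x + u *\<^sub>R b) x" for x u
  define m where "m = (\<lambda>(x, u). (u * (c \<bullet> x) - u\<^sup>2, Z x u + transpose (Z x u)))"
  \<comment> \<open>Strict separation needs a compact set. The hull of the rank-one points is
    compact, and it lies in \<open>dual_image\<close> by convexity.\<close>
  define C where "C = convex hull (m ` sphere 0 1)"
  have dim: "x \<bullet> x + u\<^sup>2 = 1" if "(x, u) \<in> sphere (0 :: (real^'n) \<times> real) 1" for x u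
    using that by (simp add: norm_Pair power2_norm_eq_inner)
  have "m ` sphere 0 1 \<subseteq> dual_image A b c"
  proof (rule image_subsetI)
    fix p :: "(real^'n) \<times> real"
    assume p: "p \<in> sphere 0 1"
    obtain x u where xu: "p = (x, u)" by force
    with p have "(x, u) \<in> sphere 0 1" by simp
    note feasible = dual_feasible_rank_one[OF dim[OF this]]
    have "Z x u = A ** outer_product x x + outer_product b (u *\<^sub>R x)"
      by (simp add: Z_def vec_eq_iff matrix_matrix_mult_def matrix_vector_mult_def
          outer_product_def sum_distrib_left sum_distrib_right algebra_simps)
    then show "m p \<in> dual_image A b c"
      unfolding dual_image_def m_def xu using feasible by force
  qed
  then have C: "C \<subseteq> dual_image A b c"
    unfolding C_def by (rule hull_minimal) (rule convex_dual_image)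
  have "continuous_on (sphere 0 1) (\<lambda>p :: (real^'n) \<times> real. A *v fst p)"
    by (intro linear_continuous_on_compose[OF _ matrix_vector_mul_linear] continuous_intros)
  then have "continuous_on (sphere 0 1) m"
    unfolding m_def Z_def split_def outer_product_def transpose_def
    by (simp add: continuous_intros)
  then have "compact C"
    unfolding C_def by (intro compact_convex_hull compact_continuous_image) auto
  define T where "T = {0::real..} \<times> {0 :: real^'n^'n}"
  have "C \<inter> T = {}"
  proof (rule ccontr)
    assume "C \<inter> T \<noteq> {}"
    then obtain r where "r \<ge> 0" "(r, 0) \<in> dual_image A b c"
      using C by (auto simp: T_def)
    then obtain X y v Z where D: "dual_feasible X y v" and r: "r = c \<bullet> y - v"
      and Z: "Z = A ** X + outer_product b y" "Z + transpose Z = 0"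
      unfolding dual_image_def by auto
    have Zv: "Z *v \<xi> = A *v (X *v \<xi>) + (y \<bullet> \<xi>) *\<^sub>R b" for \<xi>
      unfolding Z(1) by (simp add: matrix_vector_mult_add_rdistrib outer_product_mult flip: matrix_vector_mul_assoc)
    have "\<eta> \<bullet> (Z *v \<xi>) = - (\<xi> \<bullet> (Z *v \<eta>))" for \<xi> \<eta>
    proof -
      have "\<eta> \<bullet> ((Z + transpose Z) *v \<xi>) = \<eta> \<bullet> (Z *v \<xi>) + \<xi> \<bullet> (Z *v \<eta>)"
        using inner_transpose_mult[of \<eta> Z \<xi>]
        by (simp add: matrix_vector_mult_add_rdistrib inner_add_right inner_commute)
      then show ?thesis using Z(2) by simp
    qed
    then have skew: "\<eta> \<bullet> (A *v (X *v \<xi>) + (y \<bullet> \<xi>) *\<^sub>R b) = - (\<xi> \<bullet> (A *v (X *v \<eta>) + (y \<bullet> \<eta>) *\<^sub>R b))" for \<xi> \<eta>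
      unfolding Zv by blast
    have "c \<bullet> y < v"
      by (rule dual_infeasible[of A b c, OF _ D skew]) (rule freq)
    then show False using r \<open>r \<ge> 0\<close> by simp
  qed
  have "closed T" "convex T"
    unfolding T_def by (auto intro!: closed_Times convex_Times)
  moreover have "C \<noteq> {}" "convex C"
    by (simp_all add: C_def convex_convex_hull)
  ultimately obtain q \<beta> where q: "\<And>p. p \<in> T \<Longrightarrow> q \<bullet> p < \<beta>" "\<And>p. p \<in> C \<Longrightarrow> \<beta> < q \<bullet> p"
    using separating_hyperplane_closed_compact[of T C] \<open>compact C\<close> \<open>C \<inter> T = {}\<close> by blast
  obtain a Q where aQ: "q = (a, Q)" by force
  have "\<beta> > 0" using q(1)[of "(0, 0)"] by (simp add: T_def aQ)
  \<comment> \<open>\<open>Q\<close> is paired with \<open>Z + transpose Z\<close>, so only its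
    symmetrisation matters. The sign is reversed, here and for \<open>a\<close>, because the
    separation makes the functional positive on \<open>C\<close>.\<close>
  define P where "P = - (Q + transpose Q)"
  show ?thesis
  proof (intro exI[of _ P] exI[of _ "- a"] conjI allI impI)
    show "transpose P = P" by (simp add: P_def transpose_def vec_eq_iff)
    fix x :: "real^'n" and u :: real
    assume "x \<noteq> 0 \<or> u \<noteq> 0"
    \<comment> \<open>The inequality is homogeneous of degree 2 in \<open>(x, u)\<close>, so it is
      enough to have it on the unit sphere.\<close>
    define l where "l = norm (x, u)"
    have "l > 0" using \<open>x \<noteq> 0 \<or> u \<noteq> 0\<close> by (auto simp: l_def zero_prod_def)
    define x' u' where "x' = (1 / l) *\<^sub>R x" and "u' = u / l"
    have x: "x = l *\<^sub>R x'" "u = l * u'" using \<open>l > 0\<close> by (auto simp: x'_def u'_def)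
    have "norm (x', u') = norm ((1 / l) *\<^sub>R (x, u))"
      by (simp add: x'_def u'_def)
    also have "\<dots> = 1" unfolding norm_scaleR l_def[symmetric] using \<open>l > 0\<close> by simp
    finally have "(x', u') \<in> sphere 0 1" by simp
    then have "m (x', u') \<in> C" unfolding C_def by (intro hull_inc imageI)
    from q(2)[OF this] have "0 < q \<bullet> m (x', u')" using \<open>\<beta> > 0\<close> by linarith
    also have "q \<bullet> m (x', u') = a * (u' * (c \<bullet> x') - u'\<^sup>2) + (Q + transpose Q) \<bullet> Z x' u'"
      by (simp add: aQ m_def inner_add_left inner_add_right inner_transpose)
    also have "(Q + transpose Q) \<bullet> Z x' u' = - ((P *v x') \<bullet> (A *v x' + u' *\<^sub>R b))"
    proof -
      have "P *v x' = - ((Q + transpose Q) *v x')"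
        by (simp add: P_def matrix_vector_mult_def vec_eq_iff algebra_simps flip: sum_negf)
      then show ?thesis by (simp add: Z_def inner_outer_product inner_commute)
    qed
    finally have "(P *v x') \<bullet> (A *v x' + u' *\<^sub>R b) + - a * (u' * (c \<bullet> x') - u'\<^sup>2) < 0" by simp
    then have "l\<^sup>2 * ((P *v x') \<bullet> (A *v x' + u' *\<^sub>R b) + - a * (u' * (c \<bullet> x') - u'\<^sup>2)) < 0"
      using \<open>l > 0\<close> by (simp add: mult_pos_neg)
    also have "l\<^sup>2 * ((P *v x') \<bullet> (A *v x' + u' *\<^sub>R b) + - a * (u' * (c \<bullet> x') - u'\<^sup>2))
        = (P *v x) \<bullet> (A *v x + u *\<^sub>R b) + - a * (u * (c \<bullet> x) - u\<^sup>2)"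
      unfolding x by (simp add: matrix_vector_mult_scaleR inner_add_right power2_eq_square algebra_simps)
    finally show "(P *v x) \<bullet> (A *v x + u *\<^sub>R b) + - a * (u * (c \<bullet> x) - u\<^sup>2) < 0" .
  qed
qed

section \<open>Eigenvalues and the frequency condition\<close>

definition complex_of_parts :: "real^'n \<Rightarrow> real^'n \<Rightarrow> complex^'n" where
  "complex_of_parts p q = (\<chi> i. Complex (p $ i) (q $ i))"

lemma complex_of_parts_cases:
  obtains p q where "v = complex_of_parts p q"
proof
  show "v = complex_of_parts (\<chi> i. Re (v $ i)) (\<chi> i. Im (v $ i))"
    by (simp add: vec_eq_iff complex_of_parts_def)
qed

lemma complex_of_parts_eq_iff: "complex_of_parts p q = complex_of_parts p' q' \<longleftrightarrow> p = p' \<and> q = q'"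
  by (auto simp: vec_eq_iff complex_of_parts_def)

lemma complex_of_parts_eq_0_iff: "complex_of_parts p q = 0 \<longleftrightarrow> p = 0 \<and> q = 0"
  by (auto simp: vec_eq_iff complex_of_parts_def complex_eq_iff)

lemma complex_of_parts_diff:
  "complex_of_parts p q - complex_of_parts p' q' = complex_of_parts (p - p') (q - q')"
  by (simp add: vec_eq_iff complex_of_parts_def complex_eq_iff)

lemma complex_of_parts_scale:
  "z *s complex_of_parts p q = complex_of_parts (Re z *\<^sub>R p - Im z *\<^sub>R q) (Im z *\<^sub>R p + Re z *\<^sub>R q)"
  by (simp add: vec_eq_iff complex_of_parts_def complex_eq_iff)

lemma complex_matrix_mult_parts:
  "complex_matrix A *v complex_of_parts p q = complex_of_parts (A *v p) (A *v q)"
  by (simp add: vec_eq_iff complex_of_parts_def matrix_vector_mult_def map_matrix_def complex_eq_iff)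

lemma complex_vector_parts: "complex_vector b = complex_of_parts b 0"
  by (simp add: complex_vector_def complex_of_parts_def vec_eq_iff complex_eq_iff)

lemma complex_eigenvalue_iff_real:
  "complex_eigenvalue A z \<longleftrightarrow> (\<exists>p q. (p \<noteq> 0 \<or> q \<noteq> 0) \<and>
     A *v p = Re z *\<^sub>R p - Im z *\<^sub>R q \<and> A *v q = Im z *\<^sub>R p + Re z *\<^sub>R q)"
  (is "_ \<longleftrightarrow> ?R")
proof
  assume "complex_eigenvalue A z"
  then obtain v where v: "v \<noteq> 0" "complex_matrix A *v v = z *s v"
    by (auto simp: complex_eigenvalue_def)
  obtain p q where "v = complex_of_parts p q" by (rule complex_of_parts_cases)
  with v show ?R
    by (auto simp: complex_matrix_mult_parts complex_of_parts_scale complex_of_parts_eq_iff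
        complex_of_parts_eq_0_iff)
next
  assume ?R
  then obtain p q where "p \<noteq> 0 \<or> q \<noteq> 0" "A *v p = Re z *\<^sub>R p - Im z *\<^sub>R q"
    "A *v q = Im z *\<^sub>R p + Re z *\<^sub>R q" by blast
  then have "complex_of_parts p q \<noteq> 0 \<and> complex_matrix A *v complex_of_parts p q = z *s complex_of_parts p q"
    by (simp add: complex_matrix_mult_parts complex_of_parts_scale complex_of_parts_eq_0_iff)
  then show "complex_eigenvalue A z" unfolding complex_eigenvalue_def by blast
qed

lemma complex_eigenvalue_real_iff:
  "complex_eigenvalue A (complex_of_real x) \<longleftrightarrow> (\<exists>v. v \<noteq> 0 \<and> A *v v = x *\<^sub>R v)"
  unfolding complex_eigenvalue_iff_real by auto

text \<open>Unless it is zero, \<open>p + \<i> q\<close> is an eigenvector for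
  \<open>\<i> w\<close>. The lemma serves as the uniqueness statement for real systems of this
  shape.\<close>

lemma imaginary_eigenvector:
  assumes "\<forall>z. complex_eigenvalue A z \<longrightarrow> Re z \<noteq> 0"
    and "A *v p = - w *\<^sub>R q" "A *v q = w *\<^sub>R p"
  shows "p = 0" "q = 0"
proof -
  have "\<not> complex_eigenvalue A (Complex 0 w)" using assms(1) by force
  then show "p = 0" "q = 0"
    using assms(2,3) unfolding complex_eigenvalue_iff_real by auto
qed

section \<open>The resolvent on the imaginary axis\<close>

lemma mat_mult_vec: "mat s *v x = s *s x" for x :: "'a::comm_semiring_1^'n"
  by (simp add: vec_eq_iff matrix_vector_mult_def mat_def if_distrib[where f = "\<lambda>a. a * _"] cong: if_cong)

text \<open>\<open>matrix_inv\<close> is a choice, so a two-sided inverse must first be shown to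
  exist: a trivial kernel gives a left inverse, which for square matrices is also a right
  one.\<close>

lemma matrix_inv_right:
  fixes M :: "'a::field^'n^'n"
  assumes "\<And>x. M *v x = 0 \<Longrightarrow> x = 0"
  shows "M *v (matrix_inv M *v x) = x"
proof -
  have "\<exists>N. M ** N = mat 1 \<and> N ** M = mat 1"
    using assms matrix_left_invertible_ker matrix_left_right_inverse by metis
  then have "M ** matrix_inv M = mat 1"
    unfolding matrix_inv_def by (metis (mono_tags, lifting) someI_ex)
  then show ?thesis by (simp add: matrix_vector_mul_assoc)
qed

text \<open>Here \<open>p + \<i> q\<close> is the resolvent of \<open>A\<close> at
  \<open>\<i> w\<close> applied to \<open>b\<close>; the point \<open>\<i> w\<close> is not an
  eigenvalue, so the inverse is genuine.\<close>

lemma transfer_function_parts: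
  fixes A :: "real^'n^'n"
  assumes ev: "\<forall>z. complex_eigenvalue A z \<longrightarrow> Re z \<noteq> 0"
  shows "\<exists>p q. A *v p + b = - w *\<^sub>R q \<and> A *v q = w *\<^sub>R p \<and>
    Re (transfer_function c A b (\<i> * complex_of_real w)) = c \<bullet> p"
proof -
  define s where "s = \<i> * complex_of_real w"
  define M where "M = mat s - complex_matrix A"
  have M: "M *v x = s *s x - complex_matrix A *v x" for x
    by (simp add: M_def matrix_vector_mult_diff_rdistrib mat_mult_vec)
  have ker: "x = 0" if "M *v x = 0" for x
  proof (rule ccontr)
    assume "x \<noteq> 0"
    moreover have "complex_matrix A *v x = s *s x" using that M by simp
    ultimately have "complex_eigenvalue A s" unfolding complex_eigenvalue_def by blast
    then show False using ev by (auto simp: s_def)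
  qed
  obtain p q where x: "matrix_inv M *v complex_vector b = complex_of_parts p q"
    by (rule complex_of_parts_cases)
  have "M *v complex_of_parts p q = complex_of_parts b 0"
    unfolding x[symmetric] complex_vector_parts[symmetric] by (rule matrix_inv_right) (rule ker)
  then have *: "- w *\<^sub>R q - A *v p = b" "w *\<^sub>R p - A *v q = 0"
    by (auto simp: M complex_matrix_mult_parts complex_of_parts_scale complex_of_parts_diff
        complex_of_parts_eq_iff s_def)
  have "A *v p + b = - w *\<^sub>R q" unfolding *(1)[symmetric] by simp
  moreover have "A *v q = w *\<^sub>R p" using *(2) by simp
  moreover have "Re (transfer_function c A b s) = c \<bullet> p"
    unfolding transfer_function_def M_def[symmetric] x
    by (simp add: complex_of_parts_def complex_vector_def inner_vec_def)
  ultimately show ?thesis unfolding s_def by blast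
qed

text \<open>This provides the hypothesis of \<open>kyp_lemma\<close> for \<open>\<kappa> c\<close>.
  Writing \<open>f + \<i> e\<close> as \<open>s + \<i> t\<close> times \<open>p + \<i> q\<close>
  turns the left-hand side into \<open>(s^2 + t^2) (\<kappa> (c \<bullet> p) - 1)\<close>.\<close>

lemma frequency_inequality:
  fixes A :: "real^'n^'n"
  assumes ev: "\<forall>z. complex_eigenvalue A z \<longrightarrow> Re z \<noteq> 0"
    and iv: "\<forall>w. 1 - Re (complex_of_real \<kappa> * transfer_function c A b (\<i> * complex_of_real w)) > 0"
    and f: "A *v f + s *\<^sub>R b = - w *\<^sub>R e" and e: "A *v e + t *\<^sub>R b = w *\<^sub>R f"
    and nz: "f \<noteq> 0 \<or> e \<noteq> 0"
  shows "s * ((\<kappa> *\<^sub>R c) \<bullet> f - s) + t * ((\<kappa> *\<^sub>R c) \<bullet> e - t) < 0"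
proof -
  obtain p q where p: "A *v p + b = - w *\<^sub>R q" and q: "A *v q = w *\<^sub>R p"
    and tf: "Re (transfer_function c A b (\<i> * complex_of_real w)) = c \<bullet> p"
    using transfer_function_parts[OF ev] by blast
  have p': "A *v p = - w *\<^sub>R q - b" using p by (simp add: eq_diff_eq)
  have f': "A *v f = - w *\<^sub>R e - s *\<^sub>R b" using f by (simp add: eq_diff_eq)
  have e': "A *v e = w *\<^sub>R f - t *\<^sub>R b" using e by (simp add: eq_diff_eq)
  \<comment> \<open>By uniqueness, \<open>f + \<i> e\<close> is \<open>s + \<i> t\<close> times the resolvent applied to \<open>b\<close>.\<close>
  have "A *v (f - (s *\<^sub>R p - t *\<^sub>R q)) = - w *\<^sub>R (e - (s *\<^sub>R q + t *\<^sub>R p))"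
    by (simp add: matrix_vector_mult_diff_distrib matrix_vector_mult_scaleR p' q f' algebra_simps)
  moreover have "A *v (e - (s *\<^sub>R q + t *\<^sub>R p)) = w *\<^sub>R (f - (s *\<^sub>R p - t *\<^sub>R q))"
    by (simp add: matrix_vector_mult_diff_distrib matrix_vector_right_distrib matrix_vector_mult_scaleR p' q e' algebra_simps)
  ultimately have fe: "f = s *\<^sub>R p - t *\<^sub>R q" "e = s *\<^sub>R q + t *\<^sub>R p"
    using imaginary_eigenvector[OF ev] by (metis eq_iff_diff_eq_0)+
  have "s \<noteq> 0 \<or> t \<noteq> 0" using nz fe by auto
  then have "s\<^sup>2 + t\<^sup>2 > 0" by (simp add: sum_power2_gt_zero_iff)
  moreover have "\<kappa> * (c \<bullet> p) - 1 < 0" using iv[rule_format, of w] by (simp add: tf)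
  ultimately have "(s\<^sup>2 + t\<^sup>2) * (\<kappa> * (c \<bullet> p) - 1) < 0" by (rule mult_pos_neg)
  also have "(s\<^sup>2 + t\<^sup>2) * (\<kappa> * (c \<bullet> p) - 1)
      = s * ((\<kappa> *\<^sub>R c) \<bullet> f - s) + t * ((\<kappa> *\<^sub>R c) \<bullet> e - t)"
    by (simp add: fe inner_diff_right inner_add_right power2_eq_square algebra_simps)
  finally show ?thesis .
qed

section \<open>Negative eigenvalues of the product\<close>

lemma common_lyapunov_imp_no_negative_eigenvalue:
  fixes A B P :: "real^'n^'n"
  assumes P: "transpose P = P"
    and A: "\<And>x. x \<noteq> 0 \<Longrightarrow> (P *v x) \<bullet> (A *v x) < 0"
    and B: "\<And>x. x \<noteq> 0 \<Longrightarrow> (P *v x) \<bullet> (B *v x) < 0"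
    and "x < 0"
  shows "\<not> complex_eigenvalue (A ** B) (complex_of_real x)"
proof
  assume "complex_eigenvalue (A ** B) (complex_of_real x)"
  then obtain v where v: "v \<noteq> 0" "A *v (B *v v) = x *\<^sub>R v"
    by (auto simp: complex_eigenvalue_real_iff matrix_vector_mul_assoc)
  have "B *v v \<noteq> 0" using v \<open>x < 0\<close> by auto
  from A[OF this] have "x * ((P *v (B *v v)) \<bullet> v) < 0" using v by simp
  moreover have "(P *v (B *v v)) \<bullet> v = (P *v v) \<bullet> (B *v v)"
    by (metis P inner_commute inner_transpose_mult)
  ultimately have "0 < (P *v v) \<bullet> (B *v v)"
    using \<open>x < 0\<close> by (simp add: mult_less_0_iff)
  then show False using B[OF v(1)] by simp
qed

lemma no_negative_eigenvalue_imp_frequency: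
  fixes A :: "real^'n^'n"
  assumes evA: "\<forall>z. complex_eigenvalue A z \<longrightarrow> Re z \<noteq> 0"
    and evB: "\<forall>z. complex_eigenvalue B z \<longrightarrow> Re z \<noteq> 0"
    and B: "B = A + \<kappa> *\<^sub>R outer_product b c"
    and iii: "\<And>x. x < 0 \<Longrightarrow> \<not> complex_eigenvalue (A ** B) (complex_of_real x)"
  shows "1 - Re (complex_of_real \<kappa> * transfer_function c A b (\<i> * complex_of_real w)) > 0"
proof -
  define g where "g w = Re (complex_of_real \<kappa> * transfer_function c A b (\<i> * complex_of_real w))" for w
  have parts: "\<exists>p q. A *v p + b = - w *\<^sub>R q \<and> A *v q = w *\<^sub>R p \<and> g w = \<kappa> * (c \<bullet> p)" for w
    using transfer_function_parts[OF evA, of b w c] by (auto simp: g_def simp del: scaleR_minus_left)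
  then obtain p q where p: "A *v p w + b = - w *\<^sub>R q w" and q: "A *v q w = w *\<^sub>R p w"
    and g: "g w = \<kappa> * (c \<bullet> p w)" for w
    by metis
  have p': "A *v p w = - w *\<^sub>R q w - b" for w using p[of w] by (simp add: eq_diff_eq)
  have Bv: "B *v x = A *v x + (\<kappa> * (c \<bullet> x)) *\<^sub>R b" for x
    by (simp add: B matrix_vector_mult_add_rdistrib outer_product_mult flip: scaleR_matrix_vector_assoc)
  have not1: "g w \<noteq> 1" for w
  proof
    assume "g w = 1"
    then have Bp: "B *v p w = - w *\<^sub>R q w" using p[of w] g[of w] by (simp add: Bv)
    moreover have "p w \<noteq> 0" using \<open>g w = 1\<close> g[of w] by auto
    ultimately show False
    proof (cases "w = 0")
      case True
      \<comment> \<open>At zero frequency \<open>p w\<close> lies in the kernel of \<open>B\<close>,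
        and 0 counts as an imaginary eigenvalue.\<close>
      with Bp have "B *v p w = - 0 *\<^sub>R (0::real^'n)" "B *v 0 = 0 *\<^sub>R p w" by auto
      then show False using imaginary_eigenvector[OF evB] \<open>p w \<noteq> 0\<close> by blast
    next
      case False
      have "(A ** B) *v p w = (- w\<^sup>2) *\<^sub>R p w"
        unfolding matrix_vector_mul_assoc[symmetric] Bp
        by (simp add: matrix_vector_mult_scaleR linear_neg[OF matrix_vector_mul_linear] q power2_eq_square)
      then have "complex_eigenvalue (A ** B) (complex_of_real (- w\<^sup>2))"
        using \<open>p w \<noteq> 0\<close> unfolding complex_eigenvalue_real_iff by blast
      then show False using iii[of "- w\<^sup>2"] False by simp
    qed
  qed
  \<comment> \<open>Eliminating \<open>q\<close> leaves a real linear system for \<open>p w\<close>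
    with a constant right-hand side. Its matrix has entries polynomial in \<open>w\<close>, so
    Cramer's rule will give continuity of \<open>p\<close>.\<close>
  define N where "N w = A ** A + mat (w\<^sup>2)" for w
  have Nv: "N w *v x = A *v (A *v x) + w\<^sup>2 *\<^sub>R x" for w x
    by (simp add: N_def matrix_vector_mult_add_rdistrib matrix_vector_mul_assoc mat_mult_vec
        scalar_mult_eq_scaleR)
  have Np: "N w *v p w = - (A *v b)" for w
    by (simp add: Nv p' matrix_vector_mult_diff_distrib matrix_vector_mult_scaleR
        linear_neg[OF matrix_vector_mul_linear] q power2_eq_square)
  have detN: "det (N w) \<noteq> 0" for w
  proof -
    have "x = 0" if "N w *v x = 0" for x
    proof (cases "w = 0")
      case True
      then have "A *v (A *v x) = - 0 *\<^sub>R (0::real^'n)" using that by (simp add: Nv)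
      then have "A *v x = - 0 *\<^sub>R (0::real^'n)"
        using imaginary_eigenvector(1)[OF evA, of "A *v x" 0 0] by simp
      then show ?thesis using imaginary_eigenvector(1)[OF evA, of x 0 0] by simp
    next
      case False
      \<comment> \<open>With this \<open>y\<close>, the vector \<open>x + \<i> y\<close> would be an
        eigenvector of \<open>A\<close> for \<open>\<i> w\<close>.\<close>
      define y where "y = (- 1 / w) *\<^sub>R (A *v x)"
      have "A *v x = - w *\<^sub>R y" using False by (simp add: y_def)
      moreover have "A *v (A *v x) = - w\<^sup>2 *\<^sub>R x" using that by (simp add: Nv eq_neg_iff_add_eq_0)
      then have "A *v y = w *\<^sub>R x"
        using False by (simp add: y_def matrix_vector_mult_scaleR linear_neg[OF matrix_vector_mul_linear] power2_eq_square)
      ultimately show ?thesis using imaginary_eigenvector(1)[OF evA] by blast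
    qed
    then have "invertible (N w)"
      unfolding invertible_left_inverse matrix_left_invertible_ker by blast
    then show ?thesis by (simp add: invertible_det_nz)
  qed
  have cont_det: "continuous_on S (\<lambda>w. det (f w))"
    if "\<And>i j. continuous_on S (\<lambda>w. f w $ i $ j)" for f :: "real \<Rightarrow> real^'n^'n" and S
    unfolding det_def
    by (intro continuous_on_sum continuous_on_mult continuous_on_const continuous_on_prod that)
  have "continuous_on S p" for S
  proof -
    have "p = (\<lambda>w. \<chi> k. det (\<chi> i j. if j = k then (- (A *v b)) $ i else N w $ i $ j) / det (N w))"
      using cramer[OF detN] Np by blast
    moreover have comp: "continuous_on S (\<lambda>w. N w $ i $ j)" for i j
      unfolding N_def mat_def by (cases "i = j") (auto intro!: continuous_intros)
    then have "continuous_on S (\<lambda>w. \<chi> k. det (\<chi> i j. if j = k then (- (A *v b)) $ i else N w $ i $ j) / det (N w))"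
    proof (intro continuous_on_vec_lambda continuous_on_divide cont_det ballI detN)
      fix k i j
      show "continuous_on S (\<lambda>w. (\<chi> i j. if j = k then (- (A *v b)) $ i else N w $ i $ j) $ i $ j)"
        using comp by (cases "j = k") (simp_all add: continuous_on_const)
    qed
    ultimately show ?thesis by simp
  qed
  then have cont: "continuous_on S g" for S
    unfolding g[abs_def] by (intro continuous_intros)
  obtain K where K: "K > 0" "\<And>x. norm (A *v (A *v x)) \<le> K * norm x"
    using linear_bounded_pos[OF linear_compose[OF matrix_vector_mul_linear[of A] matrix_vector_mul_linear[of A]]]
    by (auto simp: mult.commute)
  \<comment> \<open>Once \<open>w^2 > K\<close>, the system bounds \<open>norm (p w)\<close> by
    \<open>norm (A b) / (w^2 - K)\<close>, and hence \<open>g w\<close> by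
    \<open>L / (w^2 - K)\<close>.\<close>
  define L where "L = \<bar>\<kappa>\<bar> * norm c * norm (A *v b)"
  have large: "g w < 1" if "w\<^sup>2 > K + L" for w
  proof (rule ccontr)
    assume "\<not> g w < 1"
    then have "1 \<le> \<bar>\<kappa>\<bar> * \<bar>c \<bullet> p w\<bar>" unfolding g abs_mult[symmetric] by linarith
    also have "\<dots> \<le> \<bar>\<kappa>\<bar> * (norm c * norm (p w))"
      by (intro mult_left_mono Cauchy_Schwarz_ineq2) auto
    finally have 1: "1 \<le> (\<bar>\<kappa>\<bar> * norm c) * norm (p w)" by simp
    have "w\<^sup>2 *\<^sub>R p w = - (A *v b) - A *v (A *v p w)"
      using Np[of w] by (simp add: Nv eq_diff_eq add.commute)
    then have "norm (w\<^sup>2 *\<^sub>R p w) \<le> norm (A *v b) + norm (A *v (A *v p w))"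
      by (metis norm_minus_cancel norm_triangle_ineq4)
    then have 2: "(w\<^sup>2 - K) * norm (p w) \<le> norm (A *v b)"
      using K(2)[of "p w"] by (simp add: left_diff_distrib)
    have "0 \<le> L" by (simp add: L_def)
    then have "w\<^sup>2 - K \<le> (w\<^sup>2 - K) * ((\<bar>\<kappa>\<bar> * norm c) * norm (p w))"
      using that mult_left_mono[OF 1, of "w\<^sup>2 - K"] by simp
    also have "\<dots> = (\<bar>\<kappa>\<bar> * norm c) * ((w\<^sup>2 - K) * norm (p w))" by (simp add: mult_ac)
    also have "\<dots> \<le> L" unfolding L_def by (rule mult_left_mono[OF 2]) simp
    finally show False using that by simp
  qed
  have "g w < 1"
  proof (rule ccontr)
    assume w: "\<not> g w < 1"
    \<comment> \<open>This point lies to the right of \<open>w\<close>, and being at least 1 it is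
      at most its own square, so \<open>large\<close> applies to it.\<close>
    define w1 where "w1 = \<bar>w\<bar> + K + L + 1"
    have "0 \<le> L" by (simp add: L_def)
    then have "w1 \<ge> 1" "w \<le> w1" "K + L < w1" using K(1) by (auto simp: w1_def)
    moreover have "w1 \<le> w1\<^sup>2" using \<open>w1 \<ge> 1\<close> by (simp add: power2_eq_square)
    ultimately have "g w1 < 1" using large by simp
    then obtain x where "g x = 1"
      using IVT2'[of g w1 1 w] w \<open>w \<le> w1\<close> cont by auto
    then show False using not1 by blast
  qed
  then show ?thesis by (simp add: g_def)
qed

section \<open>Stability and positive Lyapunov matrices\<close>

definition poly_apply :: "complex^'n^'n \<Rightarrow> complex poly \<Rightarrow> complex^'n \<Rightarrow> complex^'n" where
  "poly_apply M p = fold_coeffs (\<lambda>a f v. a *s v + f (M *v v)) p (\<lambda>v. 0)"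

lemma poly_apply_0 [simp]: "poly_apply M 0 v = 0"
  by (simp add: poly_apply_def)

lemma poly_apply_pCons [simp]: "poly_apply M (pCons a p) v = a *s v + poly_apply M p (M *v v)"
  unfolding poly_apply_def by (cases "p = 0 \<and> a = 0") (auto simp: fun_eq_iff)

lemma poly_apply_add: "poly_apply M (p + q) v = poly_apply M p v + poly_apply M q v"
  by (induction p q arbitrary: v rule: poly_induct2) (simp_all add: vec_eq_iff algebra_simps)

lemma poly_apply_smult: "poly_apply M (smult a p) v = a *s poly_apply M p v"
  by (induction p arbitrary: v) (simp_all add: vec_eq_iff algebra_simps)

lemma poly_apply_diff_scale:
  "poly_apply M p (v - c *s w) = poly_apply M p v - c *s poly_apply M p w"
proof (induction p arbitrary: v w)
  case (pCons a p)
  have "M *v (v - c *s w) = M *v v - c *s (M *v w)"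
    by (simp add: matrix_vector_mult_diff_distrib vector_scalar_commute)
  then have "poly_apply M p (M *v (v - c *s w)) = poly_apply M p (M *v v) - c *s poly_apply M p (M *v w)"
    using pCons.IH by simp
  then show ?case by (simp add: vec_eq_iff algebra_simps del: vector_scalar_commute)
qed simp

lemma poly_apply_commute: "poly_apply M p (M *v v) = M *v poly_apply M p v"
proof (induction p arbitrary: v)
  case (pCons a p)
  then show ?case by (simp add: matrix_vector_right_distrib vector_scalar_commute)
qed simp

lemma poly_apply_linear_factor:
  "poly_apply M ([:- z, 1:] * q) v = poly_apply M q (M *v v - z *s v)"
proof -
  have "[:- z, 1:] * q = smult (- z) q + pCons 0 q" by simp
  then have "poly_apply M ([:- z, 1:] * q) v = poly_apply M (smult (- z) q + pCons 0 q) v" by (rule arg_cong)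
  also have "\<dots> = poly_apply M q (M *v v - z *s v)"
    unfolding poly_apply_add poly_apply_smult poly_apply_diff_scale poly_apply_pCons
    by (simp add: vec_eq_iff)
  finally show ?thesis .
qed

lemma poly_apply_monom: "poly_apply M (monom a i) v = a *s ((*v) M ^^ i) v"
  by (induction i arbitrary: v) (simp_all add: monom_0 monom_Suc funpow_swap1)

lemma poly_apply_sum: "poly_apply M (\<Sum>i\<in>I. f i) v = (\<Sum>i\<in>I. poly_apply M (f i) v)"
  by (induction I rule: infinite_finite_induct) (auto simp: poly_apply_add)

text \<open>\<open>dependent\<close> speaks of sets, so a sequence with a repeated value needs its
  own relation, with coefficients 1 and -1.\<close>

lemma linear_dependent_sequence:
  fixes x :: "nat \<Rightarrow> 'a::euclidean_space"
  shows "\<exists>u. (\<exists>i\<le>DIM('a). u i \<noteq> 0) \<and> (\<Sum>i\<le>DIM('a). u i *\<^sub>R x i) = 0"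
proof (cases "inj_on x {..DIM('a)}")
  case False
  then obtain i j where ij: "i \<le> DIM('a)" "j \<le> DIM('a)" "i \<noteq> j" "x i = x j"
    by (auto simp: inj_on_def)
  define u where "u k = (if k = i then 1 else if k = j then -1 else 0 :: real)" for k
  have "(\<Sum>k\<le>DIM('a). u k *\<^sub>R x k) = (\<Sum>k\<in>{i, j}. u k *\<^sub>R x k)"
    using ij by (intro sum.mono_neutral_right) (auto simp: u_def)
  also have "\<dots> = 0" using ij by (simp add: u_def)
  finally show ?thesis using ij by (intro exI[of _ u]) (auto simp: u_def)
next
  case True
  define S where "S = x ` {..DIM('a)}"
  have "card S > DIM('a)" using True by (simp add: S_def card_image)
  then have "dependent S" by (intro dependent_biggerset)
  then obtain u v where u: "v \<in> S" "u v \<noteq> 0" "(\<Sum>v\<in>S. u v *\<^sub>R v) = 0"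
    using dependent_finite[of S] by (auto simp: S_def)
  have "(\<Sum>i\<le>DIM('a). u (x i) *\<^sub>R x i) = 0"
    using u(3) True by (simp add: S_def sum.reindex)
  then show ?thesis using u(1,2) by (intro exI[of _ "\<lambda>i. u (x i)"]) (auto simp: S_def)
qed

text \<open>One more Krylov vector than the real dimension forces a linear relation among them. The
  polynomial depends on \<open>v\<close>, which suffices here.\<close>

lemma annihilating_polynomial:
  fixes M :: "complex^'n^'n"
  shows "\<exists>p. p \<noteq> 0 \<and> poly_apply M p v = 0"
proof -
  define x where "x i = ((*v) M ^^ i) v" for i
  obtain u i where u: "i \<le> DIM(complex^'n)" "u i \<noteq> 0" "(\<Sum>i\<le>DIM(complex^'n). u i *\<^sub>R x i) = 0"
    using linear_dependent_sequence[of x] by blast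
  define p where "p = (\<Sum>i\<le>DIM(complex^'n). monom (complex_of_real (u i)) i)"
  have "coeff p i = u i"
    unfolding p_def coeff_sum coeff_monom using u(1) by (simp add: sum.delta)
  then have "p \<noteq> 0" using u(2) by auto
  moreover have "poly_apply M p v = (\<Sum>i\<le>DIM(complex^'n). complex_of_real (u i) *s x i)"
    by (simp add: p_def poly_apply_sum poly_apply_monom x_def)
  moreover have "complex_of_real r *s y = r *\<^sub>R y" for r and y :: "complex^'n"
    by (simp add: vec_eq_iff scaleR_conv_of_real[where 'a = complex])
  ultimately show ?thesis using u(3) by auto
qed

text \<open>Split off a root \<open>z\<close> with cofactor \<open>q\<close>. Either
  \<open>q\<close> already annihilates \<open>v\<close> and \<open>z\<close> is dropped, or
  \<open>q(M) v\<close> is an eigenvector for \<open>z\<close>; so only eigenvalues of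
  \<open>M\<close> enter the list.\<close>

lemma poly_apply_eigenvalue_list:
  assumes "p \<noteq> 0" "poly_apply M p v = 0"
  shows "\<exists>zs. (\<forall>z\<in>set zs. \<exists>w. w \<noteq> 0 \<and> M *v w = z *s w) \<and> fold (\<lambda>z x. M *v x - z *s x) zs v = 0"
  using assms
proof (induction "degree p" arbitrary: p v rule: less_induct)
  case less
  show ?case
  proof (cases "degree p = 0")
    case True
    then obtain a where "p = [:a:]" by (meson degree_eq_zeroE)
    with less.prems have "v = 0" by simp
    then show ?thesis by (intro exI[of _ "[]"]) simp
  next
    case False
    then obtain z where "poly p z = 0"
      using fundamental_theorem_of_algebra[of p] constant_degree[of p] by auto
    then obtain q where q: "p = [:- z, 1:] * q"
      unfolding poly_eq_0_iff_dvd dvd_def by blast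
    with less.prems have "q \<noteq> 0" by auto
    have "degree p = Suc (degree q)"
      unfolding q using \<open>q \<noteq> 0\<close> by (subst degree_mult_eq) auto
    then have "degree q < degree p" by simp
    note IH = less.hyps[OF this \<open>q \<noteq> 0\<close>]
    have z: "poly_apply M q (M *v v - z *s v) = 0"
      using less.prems(2) unfolding q poly_apply_linear_factor .
    show ?thesis
    proof (cases "poly_apply M q v = 0")
      case True
      then show ?thesis by (rule IH)
    next
      case False
      have "M *v poly_apply M q v = z *s poly_apply M q v"
        using z by (simp add: poly_apply_diff_scale poly_apply_commute)
      with False IH[OF z] obtain zs where
        "\<forall>z\<in>set (z # zs). \<exists>w. w \<noteq> 0 \<and> M *v w = z *s w"
        "fold (\<lambda>z x. M *v x - z *s x) (z # zs) v = 0"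
        by auto
      then show ?thesis by blast
    qed
  qed
qed

section \<open>Decay of Euler iterates\<close>

lemma contracting_recurrence_tendsto_0:
  fixes a d :: "nat \<Rightarrow> complex"
  assumes rec: "\<And>k. a (Suc k) = r * a k + d k" and d: "d \<longlonglongrightarrow> 0" and r: "cmod r < 1"
  shows "a \<longlonglongrightarrow> 0"
proof (rule LIMSEQ_I)
  fix e :: real
  assume "e > 0"
  \<comment> \<open>With this bound on the disturbance, \<open>e / 2\<close> is a fixed point of the
    majorising recurrence, and the rest decays geometrically.\<close>
  then have "e * (1 - cmod r) / 2 > 0" using r by simp
  from LIMSEQ_D[OF d this] obtain N where N: "\<And>k. k \<ge> N \<Longrightarrow> cmod (d k) < e * (1 - cmod r) / 2"
    unfolding diff_zero by blast
  have bound: "cmod (a (N + m)) \<le> cmod r ^ m * cmod (a N) + e / 2" for m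
  proof (induction m)
    case (Suc m)
    have "cmod (a (N + Suc m)) \<le> cmod r * cmod (a (N + m)) + cmod (d (N + m))"
      using norm_triangle_ineq[of "r * a (N + m)" "d (N + m)"] by (simp add: rec norm_mult)
    also have "\<dots> \<le> cmod r * (cmod r ^ m * cmod (a N) + e / 2) + e * (1 - cmod r) / 2"
      using Suc N[of "N + m"] by (intro add_mono mult_left_mono) auto
    also have "\<dots> = cmod r ^ Suc m * cmod (a N) + e / 2" by (simp add: field_simps)
    finally show ?case .
  qed (use \<open>e > 0\<close> in simp)
  have "(\<lambda>m. cmod r ^ m * cmod (a N)) \<longlonglongrightarrow> 0 * cmod (a N)"
    using r by (intro tendsto_intros LIMSEQ_realpow_zero) auto
  then obtain M where M: "\<And>m. m \<ge> M \<Longrightarrow> cmod r ^ m * cmod (a N) < e / 2"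
    using \<open>e > 0\<close> LIMSEQ_D[of "\<lambda>m. cmod r ^ m * cmod (a N)" 0 "e / 2"] by auto
  show "\<exists>n0. \<forall>n\<ge>n0. norm (a n - 0) < e"
  proof (intro exI[of _ "N + M"] allI impI)
    fix n assume "n \<ge> N + M"
    then have "n = N + (n - N)" "n - N \<ge> M" by auto
    then show "norm (a n - 0) < e"
      using bound[of "n - N"] M[of "n - N"] by auto
  qed
qed

text \<open>Powers of \<open>1 + \<epsilon> M\<close> stand in for the matrix exponential. The
  vector \<open>y = M v - z v\<close> is annihilated by the shorter list, so the iterates of
  \<open>v\<close> obey a contracting recurrence with a disturbance that tends to 0.\<close>

lemma euler_iterates_tendsto_0:
  fixes M :: "complex^'n^'n"
  assumes "fold (\<lambda>z x. M *v x - z *s x) zs v = 0"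
    and "\<And>z. z \<in> set zs \<Longrightarrow> cmod (1 + \<epsilon> * z) < 1"
  shows "(\<lambda>k. ((\<lambda>x. x + \<epsilon> *s (M *v x)) ^^ k) v $ i) \<longlonglongrightarrow> 0"
  using assms
proof (induction zs arbitrary: v)
  case Nil
  have "((\<lambda>x. x + \<epsilon> *s (M *v x)) ^^ k) 0 = 0" for k
    by (induction k) auto
  then show ?case using Nil by simp
next
  case (Cons z zs)
  define C where "C x = x + \<epsilon> *s (M *v x)" for x
  have lin: "(C ^^ k) (a *s x + b *s y) = a *s (C ^^ k) x + b *s (C ^^ k) y" for k a b x y
  proof (induction k)
    case (Suc k)
    have "C (a *s x + b *s y) = a *s C x + b *s C y" for x y
      by (simp add: C_def matrix_vector_right_distrib vector_scalar_commute[symmetric] vec_eq_iff algebra_simps)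
    then show ?case by (simp add: Suc)
  qed simp
  define y where "y = M *v v - z *s v"
  have Cv: "C v = (1 + \<epsilon> * z) *s v + \<epsilon> *s y"
    by (simp add: C_def y_def vec_eq_iff algebra_simps)
  have "(C ^^ Suc k) v = (1 + \<epsilon> * z) *s (C ^^ k) v + \<epsilon> *s (C ^^ k) y" for k
    unfolding funpow_Suc_right o_apply Cv lin ..
  then have rec: "(C ^^ Suc k) v $ i = (1 + \<epsilon> * z) * ((C ^^ k) v $ i) + \<epsilon> * ((C ^^ k) y $ i)" for k
    by (simp only: vector_add_component vector_smult_component)
  have "(\<lambda>k. (C ^^ k) y $ i) \<longlonglongrightarrow> 0"
    using Cons.IH[of y] Cons.prems unfolding C_def y_def by simp
  then have "(\<lambda>k. \<epsilon> * ((C ^^ k) y $ i)) \<longlonglongrightarrow> 0" by (rule tendsto_mult_right_zero)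
  moreover have "cmod (1 + \<epsilon> * z) < 1" using Cons.prems by simp
  ultimately have "(\<lambda>k. (C ^^ k) v $ i) \<longlonglongrightarrow> 0"
    by (intro contracting_recurrence_tendsto_0[where a = "\<lambda>k. (C ^^ k) v $ i"
        and d = "\<lambda>k. \<epsilon> * ((C ^^ k) y $ i)", OF rec])
  then show ?case by (simp add: C_def[abs_def])
qed

lemma eventually_euler_contracting:
  assumes "Re z < 0"
  shows "\<forall>\<^sub>F \<epsilon> in at_right 0. cmod (1 + complex_of_real \<epsilon> * z) < 1"
proof -
  have "((\<lambda>\<epsilon>. 2 * Re z + \<epsilon> * (cmod z)\<^sup>2) \<longlongrightarrow> 2 * Re z + 0 * (cmod z)\<^sup>2) (at_right 0)"
    by (intro tendsto_intros)
  then have "\<forall>\<^sub>F \<epsilon> in at_right 0. 2 * Re z + \<epsilon> * (cmod z)\<^sup>2 < 0"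
    using assms by (auto dest: order_tendstoD(2)[where a = 0])
  moreover have "\<forall>\<^sub>F \<epsilon> in at_right (0::real). \<epsilon> > 0" by (rule eventually_at_right_less)
  ultimately show ?thesis
  proof eventually_elim
    case (elim \<epsilon>)
    have "(cmod (1 + complex_of_real \<epsilon> * z))\<^sup>2 = 1 + \<epsilon> * (2 * Re z + \<epsilon> * (cmod z)\<^sup>2)"
      unfolding cmod_power2 by (simp add: power2_eq_square algebra_simps)
    also have "\<dots> < 1" using elim by (simp add: mult_pos_neg)
    finally show ?case by (simp add: power_less_one_iff abs_square_less_1)
  qed
qed

text \<open>By compactness the first-order change is at most a negative multiple of
  \<open>(norm x)^2\<close>, and the second-order term is bounded by another multiple, so one
  \<open>\<epsilon>\<close> works for all \<open>x\<close>.\<close>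

lemma eventually_euler_decreasing:
  fixes A P :: "real^'n^'n"
  assumes P: "transpose P = P" and neg: "\<And>x. x \<noteq> 0 \<Longrightarrow> (P *v x) \<bullet> (A *v x) < 0"
  shows "\<forall>\<^sub>F \<epsilon> in at_right 0. \<forall>x. x \<noteq> 0 \<longrightarrow>
    (P *v (x + \<epsilon> *\<^sub>R (A *v x))) \<bullet> (x + \<epsilon> *\<^sub>R (A *v x)) < (P *v x) \<bullet> x"
proof -
  have cont: "continuous_on (sphere 0 1) (\<lambda>x. (P *v x) \<bullet> (A *v x))"
    by (intro continuous_intros linear_continuous_on linear_conv_bounded_linear[THEN iffD1]
        matrix_vector_mul_linear)
  have "sphere (0::real^'n) 1 \<noteq> {}" by simp
  then obtain x0 where x0: "x0 \<in> sphere 0 1"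
    and max: "\<And>x. x \<in> sphere 0 1 \<Longrightarrow> (P *v x) \<bullet> (A *v x) \<le> (P *v x0) \<bullet> (A *v x0)"
    using continuous_attains_sup[OF compact_sphere _ cont] by blast
  define m where "m = (P *v x0) \<bullet> (A *v x0)"
  have "m < 0" unfolding m_def using x0 by (intro neg) auto
  have m: "(P *v x) \<bullet> (A *v x) \<le> m * (norm x)\<^sup>2" for x
  proof (cases "x = 0")
    case False
    have "x /\<^sub>R norm x \<in> sphere 0 1" using False by simp
    from max[OF this] show ?thesis
      using False by (simp add: m_def matrix_vector_mult_scaleR field_simps power2_eq_square)
  qed simp
  have "linear (\<lambda>x. P *v (A *v x))"
    using linear_compose[OF matrix_vector_mul_linear[of A] matrix_vector_mul_linear[of P]] by (simp add: o_def)
  then obtain K where "K > 0" and K: "\<And>x. norm (P *v (A *v x)) \<le> K * norm x"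
    using linear_bounded_pos by blast
  obtain L where "L > 0" and L: "\<And>x. norm (A *v x) \<le> L * norm x"
    using linear_bounded_pos[OF matrix_vector_mul_linear[of A]] by blast
  have KL: "(P *v (A *v x)) \<bullet> (A *v x) \<le> K * L * (norm x)\<^sup>2" for x
  proof -
    have "(P *v (A *v x)) \<bullet> (A *v x) \<le> norm (P *v (A *v x)) * norm (A *v x)"
      by (rule norm_cauchy_schwarz)
    also have "\<dots> \<le> (K * norm x) * (L * norm x)"
      using K L \<open>K > 0\<close> by (intro mult_mono) auto
    finally show ?thesis by (simp add: power2_eq_square mult_ac)
  qed
  have "((\<lambda>\<epsilon>. 2 * m + \<epsilon> * (K * L)) \<longlongrightarrow> 2 * m + 0 * (K * L)) (at_right 0)"
    by (intro tendsto_intros)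
  then have "\<forall>\<^sub>F \<epsilon> in at_right 0. 2 * m + \<epsilon> * (K * L) < 0"
    using \<open>m < 0\<close> by (auto dest: order_tendstoD(2)[where a = 0])
  moreover have "\<forall>\<^sub>F \<epsilon> in at_right (0::real). \<epsilon> > 0" by (rule eventually_at_right_less)
  ultimately show ?thesis
  proof eventually_elim
    case (elim \<epsilon>)
    show ?case
    proof (intro allI impI)
      fix x :: "real^'n"
      assume "x \<noteq> 0"
      define y where "y = A *v x"
      have "(P *v y) \<bullet> x = (P *v x) \<bullet> y"
        by (metis P inner_commute inner_transpose_mult)
      then have "(P *v (x + \<epsilon> *\<^sub>R y)) \<bullet> (x + \<epsilon> *\<^sub>R y)
        = (P *v x) \<bullet> x + \<epsilon> * (2 * ((P *v x) \<bullet> y) + \<epsilon> * ((P *v y) \<bullet> y))"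
        by (simp add: matrix_vector_right_distrib matrix_vector_mult_scaleR inner_add_left
            inner_add_right algebra_simps)
      also have "2 * ((P *v x) \<bullet> y) + \<epsilon> * ((P *v y) \<bullet> y) \<le> (2 * m + \<epsilon> * (K * L)) * (norm x)\<^sup>2"
      proof -
        have "\<epsilon> * ((P *v y) \<bullet> y) \<le> \<epsilon> * (K * L * (norm x)\<^sup>2)"
          unfolding y_def using elim(2) by (intro mult_left_mono KL) simp
        moreover have "(2 * m + \<epsilon> * (K * L)) * (norm x)\<^sup>2 = 2 * (m * (norm x)\<^sup>2) + \<epsilon> * (K * L * (norm x)\<^sup>2)"
          by (simp add: algebra_simps)
        ultimately show ?thesis using m[of x] unfolding y_def by linarith
      qed
      then have "2 * ((P *v x) \<bullet> y) + \<epsilon> * ((P *v y) \<bullet> y) < 0"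
        using elim(1) \<open>x \<noteq> 0\<close> mult_neg_pos[of "2 * m + \<epsilon> * (K * L)" "(norm x)\<^sup>2"] by simp
      then have "(P *v x) \<bullet> x + \<epsilon> * (2 * ((P *v x) \<bullet> y) + \<epsilon> * ((P *v y) \<bullet> y)) < (P *v x) \<bullet> x"
        using elim(2) by (simp add: mult_pos_neg)
      finally show "(P *v (x + \<epsilon> *\<^sub>R (A *v x))) \<bullet> (x + \<epsilon> *\<^sub>R (A *v x)) < (P *v x) \<bullet> x"
        by (simp add: y_def)
    qed
  qed
qed

text \<open>The form \<open>V\<close> drops strictly at the first Euler step, never rises afterwards
  and tends to 0 along the iterates, so \<open>V x > V (C x) \<ge> 0\<close>.\<close>

lemma stable_imp_lyapunov_positive:
  fixes A P :: "real^'n^'n"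
  assumes "stable_matrix A" and P: "transpose P = P"
    and neg: "\<And>x. x \<noteq> 0 \<Longrightarrow> (P *v x) \<bullet> (A *v x) < 0" and "x \<noteq> 0"
  shows "0 < (P *v x) \<bullet> x"
proof -
  define M where "M = complex_matrix A"
  define v where "v = complex_of_parts x 0"
  obtain p where "p \<noteq> 0" "poly_apply M p v = 0"
    using annihilating_polynomial by blast
  then obtain zs where zs: "\<forall>z\<in>set zs. \<exists>w. w \<noteq> 0 \<and> M *v w = z *s w"
    and ann: "fold (\<lambda>z x. M *v x - z *s x) zs v = 0"
    using poly_apply_eigenvalue_list by blast
  have "\<forall>z\<in>set zs. Re z < 0"
    using zs assms(1) unfolding stable_matrix_def complex_eigenvalue_def M_def by blast
  \<comment> \<open>The list is finite, so a single step size contracts at all its eigenvalues and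
    also makes the form decrease.\<close>
  then have "\<forall>\<^sub>F \<epsilon> in at_right 0. \<forall>z\<in>set zs. cmod (1 + complex_of_real \<epsilon> * z) < 1"
    by (intro eventually_ball_finite) (auto intro: eventually_euler_contracting)
  then have "\<forall>\<^sub>F \<epsilon> in at_right 0. (\<forall>z\<in>set zs. cmod (1 + complex_of_real \<epsilon> * z) < 1) \<and>
      (\<forall>x. x \<noteq> 0 \<longrightarrow> (P *v (x + \<epsilon> *\<^sub>R (A *v x))) \<bullet> (x + \<epsilon> *\<^sub>R (A *v x)) < (P *v x) \<bullet> x)"
    by (rule eventually_conj) (rule eventually_euler_decreasing[OF P neg])
  then obtain \<epsilon> where contr: "\<And>z. z \<in> set zs \<Longrightarrow> cmod (1 + complex_of_real \<epsilon> * z) < 1"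
    and decr: "\<And>x. x \<noteq> 0 \<Longrightarrow> (P *v (x + \<epsilon> *\<^sub>R (A *v x))) \<bullet> (x + \<epsilon> *\<^sub>R (A *v x)) < (P *v x) \<bullet> x"
    using eventually_happens'[OF trivial_limit_at_right_real[of "0::real"]] by blast
  define C where "C x = x + \<epsilon> *\<^sub>R (A *v x)" for x
  define V where "V x = (P *v x) \<bullet> x" for x
  have V: "V (C x) < V x" if "x \<noteq> 0" for x
    unfolding V_def C_def using decr[OF that] .
  have "((\<lambda>x. x + complex_of_real \<epsilon> *s (M *v x)) ^^ k) v = complex_of_parts ((C ^^ k) x) 0" for k
  proof (induction k)
    case (Suc k)
    then show ?case
      by (simp add: M_def complex_matrix_mult_parts complex_of_parts_scale C_def)
        (simp add: complex_of_parts_def vec_eq_iff complex_eq_iff)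
  qed (simp add: v_def)
  then have "(\<lambda>k. complex_of_parts ((C ^^ k) x) 0 $ i) \<longlonglongrightarrow> 0" for i
    using euler_iterates_tendsto_0[OF ann contr] by simp
  then have "(\<lambda>k. Re (complex_of_parts ((C ^^ k) x) 0 $ i)) \<longlonglongrightarrow> Re 0" for i
    by (intro tendsto_Re)
  then have "(\<lambda>k. (C ^^ k) x) \<longlonglongrightarrow> 0"
    by (intro vec_tendstoI) (simp add: complex_of_parts_def)
  then have "(\<lambda>k. V ((C ^^ k) x)) \<longlonglongrightarrow> (P *v 0) \<bullet> 0"
    unfolding V_def
    by (intro tendsto_intros bounded_linear.tendsto[OF matrix_vector_mul_bounded_linear])
  \<comment> \<open>The sequence starts at \<open>C x\<close> and not at \<open>x\<close>, so that
    the strict first drop is kept.\<close>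
  from LIMSEQ_Suc[OF this] have lim: "(\<lambda>k. V ((C ^^ k) (C x))) \<longlonglongrightarrow> 0"
    by (simp add: funpow_swap1)
  have "V ((C ^^ k) (C x)) \<le> V (C x)" for k
  proof (induction k)
    case (Suc k)
    have "V (C y) \<le> V y" for y
      using V[of y] by (cases "y = 0") (auto simp: C_def)
    from this[of "(C ^^ k) (C x)"] Suc show ?case by simp
  qed simp
  then have "0 \<le> V (C x)" by (intro LIMSEQ_le_const2[OF lim]) auto
  then show ?thesis using V[OF \<open>x \<noteq> 0\<close>] by (simp add: V_def)
qed

text \<open>Adding the inequalities at the real and imaginary parts of an eigenvector cancels the
  terms with \<open>Im z\<close>, by symmetry of \<open>P\<close>, and leaves \<open>Re z\<close>
  times a nonnegative number.\<close>

lemma lyapunov_positive_imp_stable: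
  fixes A P :: "real^'n^'n"
  assumes P: "transpose P = P" and neg: "\<And>x. x \<noteq> 0 \<Longrightarrow> (P *v x) \<bullet> (A *v x) < 0"
    and pos: "\<And>x. x \<noteq> 0 \<Longrightarrow> 0 < (P *v x) \<bullet> x"
  shows "stable_matrix A"
  unfolding stable_matrix_def
proof (intro allI impI)
  fix z
  assume "complex_eigenvalue A z"
  then obtain p q where nz: "p \<noteq> 0 \<or> q \<noteq> 0" and p: "A *v p = Re z *\<^sub>R p - Im z *\<^sub>R q"
    and q: "A *v q = Im z *\<^sub>R p + Re z *\<^sub>R q"
    by (auto simp: complex_eigenvalue_iff_real)
  have neg': "(P *v x) \<bullet> (A *v x) \<le> 0" and pos': "0 \<le> (P *v x) \<bullet> x" for x
    using neg[of x] pos[of x] by (cases "x = 0"; simp)+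
  have "(P *v q) \<bullet> p = (P *v p) \<bullet> q"
    by (metis P inner_commute inner_transpose_mult)
  then have "(P *v p) \<bullet> (A *v p) + (P *v q) \<bullet> (A *v q) = Re z * ((P *v p) \<bullet> p + (P *v q) \<bullet> q)"
    by (simp add: p q inner_diff_right inner_add_right algebra_simps)
  moreover have "(P *v p) \<bullet> (A *v p) + (P *v q) \<bullet> (A *v q) < 0"
    using nz neg neg'[of p] neg'[of q] by (meson add_neg_nonpos add_nonpos_neg)
  moreover have "0 \<le> (P *v p) \<bullet> p + (P *v q) \<bullet> q"
    using pos'[of p] pos'[of q] by simp
  ultimately show "Re z < 0" by (simp add: mult_less_0_iff)
qed

section \<open>The equivalence\<close>

theorem theorem3:
  fixes F H :: "real^'n^'n" and b c :: "real^'n" and \<alpha>1 \<alpha>2 :: real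
  assumes "unstable_matrix (F + \<alpha>1 *\<^sub>R H)"
    and "unstable_matrix (F + \<alpha>2 *\<^sub>R H)"
    and "\<forall>z. complex_eigenvalue (F + \<alpha>1 *\<^sub>R H) z \<longrightarrow> Re z \<noteq> 0"
    and "\<forall>z. complex_eigenvalue (F + \<alpha>2 *\<^sub>R H) z \<longrightarrow> Re z \<noteq> 0"
    and "rank H = 1"
    and "H = outer_product b c"
    and "controllable F b"
  shows
   "let ii = (\<exists>P :: real^'n^'n. transpose P = P \<and>
          (\<forall>\<alpha>\<in>{\<alpha>1, \<alpha>2}. negative_definite
             (P ** (F + \<alpha> *\<^sub>R H) + transpose (F + \<alpha> *\<^sub>R H) ** P)));
        iii = (\<forall>x::real. x < 0 \<longrightarrow>
          \<not> complex_eigenvalue ((F + \<alpha>1 *\<^sub>R H) ** (F + \<alpha>2 *\<^sub>R H)) (complex_of_real x));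
        iv = (\<forall>w::real. 1 - Re (complex_of_real (\<alpha>2 - \<alpha>1) *
          transfer_function c (F + \<alpha>1 *\<^sub>R H) b (\<i> * complex_of_real w)) > 0)
    in (ii \<longleftrightarrow> iii) \<and> (iii \<longleftrightarrow> iv) \<and>
       (ii \<or> iii \<or> iv \<longrightarrow>
          (\<forall>\<mu>\<in>{0<..<1}. unstable_matrix (F + ((1 - \<mu>) * \<alpha>1) *\<^sub>R H + (\<mu> * \<alpha>2) *\<^sub>R H)))"
proof -
  define A1 where "A1 = F + \<alpha>1 *\<^sub>R H"
  define A2 where "A2 = F + \<alpha>2 *\<^sub>R H"
  define \<kappa> where "\<kappa> = \<alpha>2 - \<alpha>1"
  define ii where "ii \<longleftrightarrow> (\<exists>P :: real^'n^'n. transpose P = P \<and>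
          (\<forall>\<alpha>\<in>{\<alpha>1, \<alpha>2}. negative_definite
             (P ** (F + \<alpha> *\<^sub>R H) + transpose (F + \<alpha> *\<^sub>R H) ** P)))"
  define iii where "iii \<longleftrightarrow> (\<forall>x::real. x < 0 \<longrightarrow>
          \<not> complex_eigenvalue (A1 ** A2) (complex_of_real x))"
  define iv where "iv \<longleftrightarrow> (\<forall>w::real. 1 - Re (complex_of_real \<kappa> *
          transfer_function c A1 b (\<i> * complex_of_real w)) > 0)"
  note ev = assms(3,4)[folded A1_def A2_def]
  have A2: "A2 = A1 + \<kappa> *\<^sub>R outer_product b c"
    by (simp add: A1_def A2_def \<kappa>_def assms(6) algebra_simps)
  have ii: "ii \<longleftrightarrow> (\<exists>P. transpose P = P \<and> (\<forall>x. x \<noteq> 0 \<longrightarrow> (P *v x) \<bullet> (A1 *v x) < 0) \<and>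
      (\<forall>x. x \<noteq> 0 \<longrightarrow> (P *v x) \<bullet> (A2 *v x) < 0))"
    unfolding ii_def A1_def A2_def by (auto simp: negative_definite_lyapunov_iff)
  have "ii \<Longrightarrow> iii"
    unfolding ii iii_def using common_lyapunov_imp_no_negative_eigenvalue by blast
  moreover have "iii \<Longrightarrow> iv"
    unfolding iii_def iv_def using no_negative_eigenvalue_imp_frequency[OF ev A2] by blast
  moreover have "ii" if "iv"
  proof -
    obtain P :: "real^'n^'n" and a where P: "transpose P = P" and neg: "\<And>x u. x \<noteq> 0 \<or> u \<noteq> 0 \<Longrightarrow>
        (P *v x) \<bullet> (A1 *v x + u *\<^sub>R b) + a * (u * ((\<kappa> *\<^sub>R c) \<bullet> x) - u\<^sup>2) < 0"
      using kyp_lemma[of A1 b "\<kappa> *\<^sub>R c"] frequency_inequality[OF ev(1) \<open>iv\<close>[unfolded iv_def]]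
      by blast
    have "(P *v x) \<bullet> (A1 *v x) < 0" if "x \<noteq> 0" for x
      using neg[of x 0] that by simp
    \<comment> \<open>This input turns \<open>A1 x + u b\<close> into \<open>A2 x\<close> and makes
      the factor of \<open>a\<close> vanish.\<close>
    moreover have "(P *v x) \<bullet> (A2 *v x) < 0" if "x \<noteq> 0" for x
      using neg[of x "\<kappa> * (c \<bullet> x)"] that
      by (simp add: A2 matrix_vector_mult_add_rdistrib outer_product_mult power2_eq_square
          flip: scaleR_matrix_vector_assoc)
    ultimately show ?thesis unfolding ii using P by blast
  qed
  moreover have "unstable_matrix (F + ((1 - \<mu>) * \<alpha>1) *\<^sub>R H + (\<mu> * \<alpha>2) *\<^sub>R H)"
    if "ii" and \<mu>: "\<mu> \<in> {0<..<1}" for \<mu>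
  proof
    define B where "B = (1 - \<mu>) *\<^sub>R A1 + \<mu> *\<^sub>R A2"
    have B: "F + ((1 - \<mu>) * \<alpha>1) *\<^sub>R H + (\<mu> * \<alpha>2) *\<^sub>R H = B"
      by (simp add: B_def A1_def A2_def algebra_simps)
    assume "stable_matrix (F + ((1 - \<mu>) * \<alpha>1) *\<^sub>R H + (\<mu> * \<alpha>2) *\<^sub>R H)"
    then have "stable_matrix B" by (simp add: B)
    obtain P where P: "transpose P = P" and P1: "\<And>x. x \<noteq> 0 \<Longrightarrow> (P *v x) \<bullet> (A1 *v x) < 0"
      and P2: "\<And>x. x \<noteq> 0 \<Longrightarrow> (P *v x) \<bullet> (A2 *v x) < 0"
      using \<open>ii\<close> unfolding ii by blast
    have "(P *v x) \<bullet> (B *v x) < 0" if "x \<noteq> 0" for x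
    proof -
      have "(P *v x) \<bullet> (B *v x) = (1 - \<mu>) * ((P *v x) \<bullet> (A1 *v x)) + \<mu> * ((P *v x) \<bullet> (A2 *v x))"
        by (simp add: B_def matrix_vector_mult_add_rdistrib inner_add_right flip: scaleR_matrix_vector_assoc)
      also have "\<dots> < 0"
        using \<mu> P1[OF that] P2[OF that] by (intro add_neg_neg mult_pos_neg) auto
      finally show ?thesis .
    qed
    \<comment> \<open>Stability of one convex combination makes the shared \<open>P\<close> positive
      definite, and this transfers stability to \<open>A1\<close>.\<close>
    note pos = stable_imp_lyapunov_positive[OF \<open>stable_matrix B\<close> P this]
    have "stable_matrix A1"
      by (rule lyapunov_positive_imp_stable[OF P P1 pos])
    then show False using assms(1) by (simp add: A1_def)
  qed
  ultimately show ?thesis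
    unfolding Let_def ii_def[symmetric] A1_def[symmetric] A2_def[symmetric] \<kappa>_def[symmetric]
      iii_def[symmetric] iv_def[symmetric]
    by blast
qed

end
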